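(* Suppose $J_1>J_2>0$. For each $\delta>0$ there exist constants $c=c(\delta)>0$ and $\beta_0=\beta_0(\delta)<\infty$ (possibly depending on the couplings) such that for each $\beta\ge\beta_0$ and $\mathcal S\ge c\beta^2$, if the even integer $N$ is sufficiently large then for all $\boldsymbol r,\boldsymbol r'\in\mathbb T_N$: $$\mathcal S^{-4}\bigl\langle[\hat S^x_{\boldsymbol r}]^2[\hat S^x_{\boldsymbol r'}]^2\bigr\rangle_{N,\beta}\ge1-2\delta,\qquad \mathcal S^{-4}\bigl\langle[\hat S^\alpha_{\boldsymbol r}]^2[\hat S^\alpha_{\boldsymbol r'}]^2\bigr\rangle_{N,\beta}<\delta,\ \ \alpha=y,z.$$ The analogous statement holds for $J_2>J_1>0$ with the indices $x$ and $z$ interchanged.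
   Context: Let $\mathcal S\in\{\frac12,1,\frac32,\dots\}$. On each site $\boldsymbol r$ of the torus $\mathbb T_N=(\mathbb Z/N\mathbb Z)^2$ ($N$ even) put a copy of $\mathbb C^{2\mathcal S+1}$ with basis $|M\rangle$, $M=-\mathcal S,\dots,\mathcal S$; the Hilbert space is the tensor product. Single-site operators: $\hat S^z|M\rangle=M|M\rangle$, $\hat S^{\pm}|M\rangle=\sqrt{\mathcal S(\mathcal S+1)-M(M\pm1)}\,|M\pm1\rangle$, $\hat S^x=\frac12(\hat S^++\hat S^-)$, $\hat S^y=\frac1{2i}(\hat S^+-\hat S^-)$; $\hat S^\alpha_{\boldsymbol r}$ acts at site $\boldsymbol r$. Edge types: $\langle \boldsymbol r,\boldsymbol r+\boldsymbol e_1\rangle$ is an $x$-edge if $r_1$ is even and a $z$-edge otherwise; $\langle\boldsymbol r,\boldsymbol r+\boldsymbol e_2\rangle$ is an $x$-edge if $r_2$ is even and a $z$-edge otherwise. $\hat{\mathcal H}_N=-J_1\mathcal S^{-2}\sum_{x\text{-edges}}\hat S^x_{\boldsymbol r}\hat S^x_{\boldsymbol r'}-J_2\mathcal S^{-2}\sum_{z\text{-edges}}\hat S^z_{\boldsymbol r}\hat S^z_{\boldsymbol r'}$, and $\langle\hat A\rangle_{N,\beta}=\mathrm{Tr}(\hat A e^{-\beta\hat{\mathcal H}_N})/\mathrm{Tr}(e^{-\beta\hat{\mathcal H}_N})$. *)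

theory Defs
  imports Complex_Main
begin

text \<open>Sites of the torus (Z/NZ)^2 are pairs (r1,r2) with 0 <= r1,r2 < N.
  The spin is S = d/2 with d = 2S a positive natural number.  The local basis
  vector |M> is encoded by a natural number m in {0..d} with M = m - d/2.
  A basis vector of the tensor product is a configuration: a function from
  sites to {0..d} (set to 0 outside the torus so that the basis is finite).
  Operators are matrices indexed by configurations.\<close>

type_synonym site = "nat \<times> nat"
type_synonym conf = "site \<Rightarrow> nat"
type_synonym qop = "conf \<Rightarrow> conf \<Rightarrow> complex"

datatype comp = CX | CY | CZ

definition torus :: "nat \<Rightarrow> site set" where
  "torus N = {0..<N} \<times> {0..<N}"

definition confs :: "nat \<Rightarrow> nat \<Rightarrow> conf set" where
  "confs N d = {\<sigma>. \<forall>r. (r \<in> torus N \<longrightarrow> \<sigma> r \<le> d) \<and> (r \<notin> torus N \<longrightarrow> \<sigma> r = 0)}"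

definition spinS :: "nat \<Rightarrow> real" where
  "spinS d = real d / 2"

definition Mval :: "nat \<Rightarrow> nat \<Rightarrow> real" where
  "Mval d m = real m - real d / 2"

definition opmul :: "nat \<Rightarrow> nat \<Rightarrow> qop \<Rightarrow> qop \<Rightarrow> qop" where
  "opmul N d A B = (\<lambda>\<sigma> \<tau>. \<Sum>\<rho>\<in>confs N d. A \<sigma> \<rho> * B \<rho> \<tau>)"

definition opid :: qop where
  "opid = (\<lambda>\<sigma> \<tau>. if \<sigma> = \<tau> then 1 else 0)"

primrec oppow :: "nat \<Rightarrow> nat \<Rightarrow> qop \<Rightarrow> nat \<Rightarrow> qop" where
  "oppow N d A 0 = opid"
| "oppow N d A (Suc k) = opmul N d A (oppow N d A k)"

definition optrace :: "nat \<Rightarrow> nat \<Rightarrow> qop \<Rightarrow> complex" where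
  "optrace N d A = (\<Sum>\<sigma>\<in>confs N d. A \<sigma> \<sigma>)"

definition opexp :: "nat \<Rightarrow> nat \<Rightarrow> qop \<Rightarrow> qop" where
  "opexp N d A = (\<lambda>\<sigma> \<tau>. \<Sum>k. oppow N d A k \<sigma> \<tau> / of_nat (fact k))"

definition Sz :: "nat \<Rightarrow> site \<Rightarrow> qop" where
  "Sz d r = (\<lambda>\<sigma> \<tau>. if \<sigma> = \<tau> then complex_of_real (Mval d (\<tau> r)) else 0)"

definition Splus :: "nat \<Rightarrow> site \<Rightarrow> qop" where
  "Splus d r = (\<lambda>\<sigma> \<tau>. if \<tau> r < d \<and> \<sigma> = \<tau>(r := Suc (\<tau> r))
      then complex_of_real (sqrt (spinS d * (spinS d + 1) - Mval d (\<tau> r) * (Mval d (\<tau> r) + 1)))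
      else 0)"

definition Sminus :: "nat \<Rightarrow> site \<Rightarrow> qop" where
  "Sminus d r = (\<lambda>\<sigma> \<tau>. if 0 < \<tau> r \<and> \<sigma> = \<tau>(r := \<tau> r - 1)
      then complex_of_real (sqrt (spinS d * (spinS d + 1) - Mval d (\<tau> r) * (Mval d (\<tau> r) - 1)))
      else 0)"

definition Sx :: "nat \<Rightarrow> site \<Rightarrow> qop" where
  "Sx d r = (\<lambda>\<sigma> \<tau>. (Splus d r \<sigma> \<tau> + Sminus d r \<sigma> \<tau>) / 2)"

definition Sy :: "nat \<Rightarrow> site \<Rightarrow> qop" where
  "Sy d r = (\<lambda>\<sigma> \<tau>. (Splus d r \<sigma> \<tau> - Sminus d r \<sigma> \<tau>) / (2 * \<i>))"

definition spin :: "nat \<Rightarrow> comp \<Rightarrow> site \<Rightarrow> qop" where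
  "spin d a r = (case a of CX \<Rightarrow> Sx d r | CY \<Rightarrow> Sy d r | CZ \<Rightarrow> Sz d r)"

definition nb1 :: "nat \<Rightarrow> site \<Rightarrow> site" where
  "nb1 N r = ((fst r + 1) mod N, snd r)"

definition nb2 :: "nat \<Rightarrow> site \<Rightarrow> site" where
  "nb2 N r = (fst r, (snd r + 1) mod N)"

definition ham :: "nat \<Rightarrow> nat \<Rightarrow> real \<Rightarrow> real \<Rightarrow> qop" where
  "ham N d J1 J2 = (\<lambda>\<sigma> \<tau>.
     - complex_of_real (J1 / spinS d ^ 2) *
       (\<Sum>r\<in>torus N.
          (if even (fst r) then opmul N d (Sx d r) (Sx d (nb1 N r)) \<sigma> \<tau> else 0)
        + (if even (snd r) then opmul N d (Sx d r) (Sx d (nb2 N r)) \<sigma> \<tau> else 0))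
     - complex_of_real (J2 / spinS d ^ 2) *
       (\<Sum>r\<in>torus N.
          (if odd (fst r) then opmul N d (Sz d r) (Sz d (nb1 N r)) \<sigma> \<tau> else 0)
        + (if odd (snd r) then opmul N d (Sz d r) (Sz d (nb2 N r)) \<sigma> \<tau> else 0)))"

definition thermal :: "nat \<Rightarrow> nat \<Rightarrow> real \<Rightarrow> real \<Rightarrow> real \<Rightarrow> qop \<Rightarrow> complex" where
  "thermal N d J1 J2 \<beta> A =
     (let E = opexp N d (\<lambda>\<sigma> \<tau>. - complex_of_real \<beta> * ham N d J1 J2 \<sigma> \<tau>)
      in optrace N d (opmul N d A E) / optrace N d E)"

text \<open>S^{-4} < [S^a_r]^2 [S^a_r']^2 >_{N,beta} (real part; the value is real).\<close>
definition corr :: "nat \<Rightarrow> nat \<Rightarrow> real \<Rightarrow> real \<Rightarrow> real \<Rightarrow> comp \<Rightarrow> site \<Rightarrow> site \<Rightarrow> real" where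
  "corr N d J1 J2 \<beta> a r r' =
     Re (thermal N d J1 J2 \<beta>
          (opmul N d (opmul N d (opmul N d (spin d a r) (spin d a r)) (spin d a r')) (spin d a r')))
     / spinS d ^ 4"

end

theory Submission
  imports Defs "HOL-Analysis.Analysis" "HOL-Computational_Algebra.Polynomial"
begin

text \<open>
  Let \<open>J > J'\<close> be the larger and the smaller coupling, \<open>a\<close> and \<open>b\<close> the corresponding spin
  components among \<open>x, z\<close>. Every site lies on exactly two edges of each type, so
  \<open>2 A A' \<le> A\<^sup>2 + A'\<^sup>2\<close> and the Casimir identity show that \<open>H\<close> exceeds
  \<open>- J N\<^sup>2 (1 + 1/S)\<close> by at least \<open>(J - J') / S\<^sup>2\<close> times the sum over all sites of the squares of
  the \<open>y\<close> and \<open>b\<close> components. On the other hand the Gibbs variational principle, tested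
  against the normalised projection onto the joint eigenvectors of the \<open>a\<close> components with all
  eigenvalues at least \<open>(1 - 2 \<epsilon>) S\<close>, bounds the thermal energy by
  \<open>- J N\<^sup>2 (1 - 4 \<epsilon>) + N\<^sup>2 ln (2/\<epsilon>) / \<beta>\<close>: this subspace makes up a fraction at least
  \<open>(\<epsilon>/2)^(N\<^sup>2)\<close> of the dimension, uniformly in \<open>S\<close>. Hence the \<open>y\<close> and \<open>b\<close> moments are small on
  average, and by translation invariance at every site.
\<close>

section \<open>Hermitian matrices on a finite index set\<close>

text \<open>The claim involves squares of spin components only, and these do not see the sign of a
  spin. So no order has to be propagated across the lattice: once the \<open>y\<close> and
  \<open>b\<close> second moments are small at each single site, the Casimir identity makes the
  \<open>a\<close> second moment nearly s = S(S+1) there, and positivity of (s - A^2)(s - A'^2)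
  turns two one-site bounds into a two-site bound at any distance. The obstacle is the local
  dimension 2S+1, which must not enter the free energy. Because of the prefactor S^-2, keeping a
  fixed fraction of the spectrum of each spin costs energy of order \<epsilon>, while its entropy
  deficit is at most ln(2/\<epsilon>) per site however large S is; hence \<beta>0 can be chosen
  independently of S. The remaining error is the excess of S(S+1) over S^2, relatively 1/S, and this
  is what the lower bound on S controls. In the trial vectors the weaker coupling contributes
  exactly zero, because a \<open>b\<close> component is a multiple of a commutator of the
  \<open>a\<close> and \<open>y\<close> components at one site. All bounds are per site and hold for
  every even N \<ge> 2.\<close>

definition vecs :: "'a set \<Rightarrow> ('a \<Rightarrow> complex) set" where
  "vecs C = {v. \<forall>x. x \<notin> C \<longrightarrow> v x = 0}"

definition ip :: "'a set \<Rightarrow> ('a \<Rightarrow> complex) \<Rightarrow> ('a \<Rightarrow> complex) \<Rightarrow> complex" where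
  "ip C u v = (\<Sum>x\<in>C. cnj (u x) * v x)"

definition nsq :: "'a set \<Rightarrow> ('a \<Rightarrow> complex) \<Rightarrow> real" where
  "nsq C v = (\<Sum>x\<in>C. (cmod (v x))\<^sup>2)"

definition mv :: "'a set \<Rightarrow> ('a \<Rightarrow> 'a \<Rightarrow> complex) \<Rightarrow> ('a \<Rightarrow> complex) \<Rightarrow> 'a \<Rightarrow> complex" where
  "mv C A v = (\<lambda>x. if x \<in> C then \<Sum>y\<in>C. A x y * v y else 0)"

definition herm :: "'a set \<Rightarrow> ('a \<Rightarrow> 'a \<Rightarrow> complex) \<Rightarrow> bool" where
  "herm C A \<longleftrightarrow> (\<forall>x\<in>C. \<forall>y\<in>C. A x y = cnj (A y x))"

definition orthonormal :: "'a set \<Rightarrow> 'i set \<Rightarrow> ('i \<Rightarrow> 'a \<Rightarrow> complex) \<Rightarrow> bool" where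
  "orthonormal C I f \<longleftrightarrow> (\<forall>i\<in>I. f i \<in> vecs C) \<and>
     (\<forall>i\<in>I. \<forall>j\<in>I. ip C (f i) (f j) = (if i = j then 1 else 0))"

lemma ip_self: "ip C v v = of_real (nsq C v)"
  unfolding ip_def nsq_def of_real_sum
  by (intro sum.cong refl) (simp add: complex_norm_square[symmetric] mult.commute)

lemma nsq_eq_Re_ip: "nsq C v = Re (ip C v v)"
  by (simp add: ip_self)

lemma nsq_nonneg: "nsq C v \<ge> 0"
  by (simp add: nsq_def sum_nonneg)

lemma ip_commute: "ip C u v = cnj (ip C v u)"
  by (simp add: ip_def mult.commute)

lemma ip_add_right: "ip C u (\<lambda>x. v x + w x) = ip C u v + ip C u w"
  by (simp add: ip_def distrib_left sum.distrib)

lemma ip_diff_right: "ip C u (\<lambda>x. v x - w x) = ip C u v - ip C u w"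
  by (simp add: ip_def right_diff_distrib sum_subtractf)

lemma ip_scale_right: "ip C u (\<lambda>x. c * v x) = c * ip C u v"
  by (simp add: ip_def sum_distrib_left mult_ac)

lemma ip_diff_left: "ip C (\<lambda>x. v x - w x) u = ip C v u - ip C w u"
  by (simp add: ip_def left_diff_distrib sum_subtractf)

lemma ip_scale_left: "ip C (\<lambda>x. c * v x) u = cnj c * ip C v u"
  by (simp add: ip_def sum_distrib_left mult_ac)

lemma ip_sum_right: "ip C u (\<lambda>x. \<Sum>i\<in>I. c i * f i x) = (\<Sum>i\<in>I. c i * ip C u (f i))"
proof -
  have "ip C u (\<lambda>x. \<Sum>i\<in>I. c i * f i x) = (\<Sum>x\<in>C. \<Sum>i\<in>I. c i * (cnj (u x) * f i x))"
    by (simp add: ip_def sum_distrib_left mult_ac)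
  also have "\<dots> = (\<Sum>i\<in>I. \<Sum>x\<in>C. c i * (cnj (u x) * f i x))"
    by (rule sum.swap)
  finally show ?thesis by (simp add: ip_def sum_distrib_left)
qed

lemma ip_sum_left: "ip C (\<lambda>x. \<Sum>i\<in>I. c i * f i x) u = (\<Sum>i\<in>I. cnj (c i) * ip C (f i) u)"
  by (subst ip_commute, subst ip_sum_right)
     (simp add: ip_commute[of C "f _" u])

lemma mv_vecs: "mv C A v \<in> vecs C"
  by (simp add: mv_def vecs_def)

lemma mv_scale: "mv C A (\<lambda>x. c * v x) = (\<lambda>x. c * mv C A v x)"
  by (auto simp: mv_def sum_distrib_left mult_ac)

lemma mv_add: "mv C A (\<lambda>x. u x + v x) = (\<lambda>x. mv C A u x + mv C A v x)"
  by (auto simp: mv_def distrib_left sum.distrib)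

lemma mv_diff: "mv C A (\<lambda>x. u x - v x) = (\<lambda>x. mv C A u x - mv C A v x)"
  by (auto simp: mv_def right_diff_distrib sum_subtractf)

lemma ip_mv_herm:
  assumes "herm C A"
  shows "ip C u (mv C A v) = ip C (mv C A u) v"
proof -
  have "ip C u (mv C A v) = (\<Sum>x\<in>C. \<Sum>y\<in>C. cnj (u x) * A x y * v y)"
    by (simp add: ip_def mv_def sum_distrib_left mult_ac)
  also have "\<dots> = (\<Sum>y\<in>C. \<Sum>x\<in>C. cnj (u x) * A x y * v y)"
    by (rule sum.swap)
  also have "\<dots> = (\<Sum>y\<in>C. \<Sum>x\<in>C. cnj (u x) * cnj (A y x) * v y)"
  proof (intro sum.cong refl)
    fix y x assume "y \<in> C" "x \<in> C"
    then have "A x y = cnj (A y x)" using assms unfolding herm_def by blast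
    then show "cnj (u x) * A x y * v y = cnj (u x) * cnj (A y x) * v y" by (simp only:)
  qed
  also have "\<dots> = ip C (mv C A u) v"
    by (simp add: ip_def mv_def sum_distrib_left sum_distrib_right mult_ac)
  finally show ?thesis .
qed

lemma nsq_scale: "nsq C (\<lambda>x. c * v x) = (cmod c)\<^sup>2 * nsq C v"
  by (simp add: nsq_def norm_mult power_mult_distrib sum_distrib_left)

lemma nsq_zero_iff:
  assumes "finite C" "v \<in> vecs C"
  shows "nsq C v = 0 \<longleftrightarrow> v = (\<lambda>_. 0)"
proof
  assume "nsq C v = 0"
  then have "\<forall>x\<in>C. v x = 0"
    using assms(1) by (simp add: nsq_def sum_nonneg_eq_0_iff)
  then show "v = (\<lambda>_. 0)"
    using assms(2) by (auto simp: vecs_def)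
qed (simp add: nsq_def)

lemma nsq_diff: "nsq C (\<lambda>x. u x - v x) = nsq C u - 2 * Re (ip C u v) + nsq C v"
proof -
  have "Re (ip C v u) = Re (ip C u v)" by (subst ip_commute) simp
  then show ?thesis
    by (simp add: nsq_eq_Re_ip ip_diff_left ip_diff_right)
qed

lemma Re_ip_le: "Re (ip C u v) \<le> (nsq C u + nsq C v) / 2"
  using nsq_nonneg[of C "\<lambda>x. u x - v x"] by (simp add: nsq_diff)

text \<open>The component of \<open>u\<close> orthogonal to the span of the family. Its squared norm
  is the defect in Bessel's inequality, and a nonzero residual is the seed for enlarging a set of
  eigenvectors.\<close>

definition resid :: "'a set \<Rightarrow> 'i set \<Rightarrow> ('i \<Rightarrow> 'a \<Rightarrow> complex) \<Rightarrow> ('a \<Rightarrow> complex) \<Rightarrow> 'a \<Rightarrow> complex" where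
  "resid C I f u = (\<lambda>x. u x - (\<Sum>i\<in>I. ip C (f i) u * f i x))"

lemma resid_vecs:
  assumes "orthonormal C I f" "u \<in> vecs C"
  shows "resid C I f u \<in> vecs C"
  using assms by (auto simp: resid_def orthonormal_def vecs_def)

lemma ip_resid:
  assumes "finite I" "orthonormal C I f" "j \<in> I"
  shows "ip C (f j) (resid C I f u) = 0"
proof -
  have "(\<Sum>i\<in>I. ip C (f i) u * ip C (f j) (f i)) = (\<Sum>i\<in>I. if i = j then ip C (f i) u else 0)"
    using assms by (intro sum.cong refl) (auto simp: orthonormal_def)
  then show ?thesis
    using assms by (simp add: resid_def ip_diff_right ip_sum_right)
qed

lemma nsq_resid:
  assumes "finite I" "orthonormal C I f"
  shows "nsq C (resid C I f u) = nsq C u - (\<Sum>i\<in>I. (cmod (ip C (f i) u))\<^sup>2)"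
proof -
  let ?w = "resid C I f u"
  have "ip C ?w ?w = ip C u ?w - (\<Sum>i\<in>I. cnj (ip C (f i) u) * ip C (f i) ?w)"
    unfolding resid_def by (simp add: ip_diff_left ip_sum_left)
  also have "\<dots> = ip C u ?w"
    using ip_resid[OF assms] by simp
  also have "\<dots> = ip C u u - (\<Sum>i\<in>I. ip C (f i) u * ip C u (f i))"
    unfolding resid_def by (simp add: ip_diff_right ip_sum_right)
  also have "\<dots> = ip C u u - (\<Sum>i\<in>I. of_real ((cmod (ip C (f i) u))\<^sup>2))"
    by (simp add: ip_commute[of C u "f _"] complex_norm_square[symmetric] del: of_real_power)
  finally have "ip C ?w ?w = of_real (nsq C u - (\<Sum>i\<in>I. (cmod (ip C (f i) u))\<^sup>2))"
    by (simp add: ip_self)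
  then show ?thesis by (simp add: ip_self del: of_real_diff of_real_sum)
qed

lemma bessel:
  assumes "finite I" "orthonormal C I f"
  shows "(\<Sum>i\<in>I. (cmod (ip C (f i) u))\<^sup>2) \<le> nsq C u"
  using nsq_resid[OF assms, of u] nsq_nonneg[of C "resid C I f u"] by simp

lemma orthonormal_nsq: "orthonormal C I f \<Longrightarrow> i \<in> I \<Longrightarrow> nsq C (f i) = 1"
  by (simp add: orthonormal_def nsq_eq_Re_ip)

definition unitvec :: "'a \<Rightarrow> 'a \<Rightarrow> complex" where
  "unitvec x = (\<lambda>y. if y = x then 1 else 0)"

lemma unitvec_vecs: "x \<in> C \<Longrightarrow> unitvec x \<in> vecs C"
  by (auto simp: unitvec_def vecs_def)

lemma ip_unitvec: "finite C \<Longrightarrow> x \<in> C \<Longrightarrow> ip C u (unitvec x) = cnj (u x)"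
  by (simp add: ip_def unitvec_def if_distrib cong: if_cong)

lemma nsq_unitvec: "finite C \<Longrightarrow> x \<in> C \<Longrightarrow> nsq C (unitvec x) = 1"
  by (simp add: nsq_eq_Re_ip ip_unitvec) (simp add: unitvec_def)

text \<open>Double counting of the squared entries: each vector contributes 1, while Bessel for the
  unit vector at \<open>x\<close> bounds the total of the entries at \<open>x\<close> by 1. This is
  the only form in which the dimension of the space is used.\<close>

lemma orthonormal_card_le:
  assumes "finite C" "finite I" "orthonormal C I f"
  shows "card I \<le> card C"
proof -
  have "real (card I) = (\<Sum>i\<in>I. nsq C (f i))"
    using orthonormal_nsq[OF assms(3)] by simp
  also have "\<dots> = (\<Sum>x\<in>C. \<Sum>i\<in>I. (cmod (f i x))\<^sup>2)"
    unfolding nsq_def by (rule sum.swap)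
  also have "\<dots> = (\<Sum>x\<in>C. \<Sum>i\<in>I. (cmod (ip C (f i) (unitvec x)))\<^sup>2)"
    by (simp add: ip_unitvec[OF assms(1)])
  also have "\<dots> \<le> (\<Sum>x\<in>C. 1)"
    by (intro sum_mono) (use bessel[OF assms(2,3)] nsq_unitvec[OF assms(1)] in metis)
  finally show ?thesis by simp
qed

lemma normalize_vec:
  assumes "finite C" "y \<in> vecs C" "y \<noteq> (\<lambda>_. 0)"
  obtains c where "c \<noteq> 0" "nsq C (\<lambda>x. c * y x) = 1" "(\<lambda>x. c * y x) \<in> vecs C"
proof -
  have pos: "nsq C y > 0"
    using nsq_zero_iff[OF assms(1,2)] assms(3) nsq_nonneg[of C y] by linarith
  define c where "c = complex_of_real (1 / sqrt (nsq C y))"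
  have "nsq C (\<lambda>x. c * y x) = 1"
    unfolding nsq_scale using pos by (simp add: c_def norm_divide power_divide)
  moreover have "(\<lambda>x. c * y x) \<in> vecs C"
    using assms(2) by (simp add: vecs_def)
  moreover have "c \<noteq> 0" using pos by (simp add: c_def)
  ultimately show ?thesis using that by blast
qed

section \<open>Compactness and the spectral theorem\<close>

lemma continuous_on_ip: "continuous_on UNIV (\<lambda>x. ip C v x)"
  unfolding ip_def by (intro continuous_intros continuous_on_product_coordinates)

lemma continuous_on_nsq_mv: "continuous_on UNIV (\<lambda>x. nsq C (mv C A x))"
proof -
  have "(\<lambda>x. nsq C (mv C A x)) = (\<lambda>x. \<Sum>i\<in>C. (cmod (\<Sum>y\<in>C. A i y * x y))\<^sup>2)"
    by (intro ext) (simp add: nsq_def mv_def)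
  then show ?thesis
    by (simp only:) (intro continuous_intros continuous_on_product_coordinates)
qed

lemma continuous_on_nsq: "continuous_on UNIV (\<lambda>x. nsq C x)"
  unfolding nsq_def by (intro continuous_intros continuous_on_product_coordinates)

text \<open>The ambient space is the full function space with its product topology. Coordinates in
  \<open>C\<close> lie in the unit disc and all others are pinned to 0, so Tychonoff gives a compact
  box, of which the sphere is a closed subset.\<close>

lemma compact_orth_sphere:
  fixes C :: "'a set"
  assumes "finite C"
  shows "compact {x \<in> vecs C. nsq C x = 1 \<and> (\<forall>v\<in>V. ip C v x = 0)}"
proof -
  let ?B = "\<lambda>i. if i \<in> C then cball 0 1 else {0::complex}"
  have "compactin (product_topology (\<lambda>i::'a. euclidean) UNIV) (Pi\<^sub>E UNIV ?B)"
    by (simp add: compactin_PiE)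
  then have comp: "compact (Pi\<^sub>E UNIV ?B)"
    by (simp add: euclidean_product_topology)
  have clo: "closed ({x. nsq C x = 1} \<inter> (\<Inter>v\<in>V. {x. ip C v x = 0}))"
    by (intro closed_Int closed_INT ballI closed_Collect_eq continuous_on_ip continuous_on_nsq
        continuous_on_const)
  have le1: "cmod (x i) \<le> 1" if "nsq C x = 1" "i \<in> C" for x i
  proof -
    have "(cmod (x i))\<^sup>2 \<le> nsq C x"
      unfolding nsq_def using assms that(2) by (intro member_le_sum) auto
    then show ?thesis using that(1) by (simp add: abs_square_le_1)
  qed
  have "{x \<in> vecs C. nsq C x = 1 \<and> (\<forall>v\<in>V. ip C v x = 0)}
      = Pi\<^sub>E UNIV ?B \<inter> ({x. nsq C x = 1} \<inter> (\<Inter>v\<in>V. {x. ip C v x = 0}))"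
    by (auto simp: vecs_def PiE_def Pi_def le1 split: if_splits)
  then show ?thesis
    using comp clo by (simp add: compact_Int_closed)
qed

text \<open>A unit vector \<open>x\<close> maximising the norm of \<open>A x\<close> on the invariant subspace satisfies
  \<open>A (A x) = M x\<close>, with \<open>M\<close> the maximum, so one of \<open>A x + sqrt M x\<close> and \<open>x\<close> is an
  eigenvector.\<close>

lemma orthogonal_eigenvector_exists:
  assumes fin: "finite C" and A: "herm C A"
    and V: "\<And>v. v \<in> V \<Longrightarrow> \<exists>l. mv C A v = (\<lambda>x. complex_of_real l * v x)"
    and w: "w \<in> vecs C" "w \<noteq> (\<lambda>_. 0)" "\<And>v. v \<in> V \<Longrightarrow> ip C v w = 0"
  obtains e l where "e \<in> vecs C" "nsq C e = 1" "\<And>v. v \<in> V \<Longrightarrow> ip C v e = 0"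
    "mv C A e = (\<lambda>x. complex_of_real l * e x)"
proof -
  let ?W = "{x \<in> vecs C. nsq C x = 1 \<and> (\<forall>v\<in>V. ip C v x = 0)}"
  obtain c where c: "nsq C (\<lambda>x. c * w x) = 1" "(\<lambda>x. c * w x) \<in> vecs C"
    using normalize_vec[OF fin w(1,2)] by blast
  have ne: "?W \<noteq> {}"
    using c w(3) by (auto simp: ip_scale_right intro!: exI[of _ "\<lambda>x. c * w x"])
  obtain x where x: "x \<in> ?W" and max: "\<And>y. y \<in> ?W \<Longrightarrow> nsq C (mv C A y) \<le> nsq C (mv C A x)"
    using continuous_attains_sup[OF compact_orth_sphere[OF fin, of V] ne
        continuous_on_subset[OF continuous_on_nsq_mv]] by blast
  define M where "M = nsq C (mv C A x)"
  define z where "z = mv C A x"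
  have M0: "M \<ge> 0" by (simp add: M_def nsq_nonneg)
  have orth_mv: "ip C v (mv C A y) = 0" if "v \<in> V" "ip C v y = 0" for v y
  proof -
    from V[OF that(1)] obtain l where "mv C A v = (\<lambda>x. complex_of_real l * v x)" by blast
    then show ?thesis
      by (simp add: ip_mv_herm[OF A] ip_scale_left that(2))
  qed
  have bound: "nsq C (mv C A y) \<le> M * nsq C y"
    if y: "y \<in> vecs C" "\<And>v. v \<in> V \<Longrightarrow> ip C v y = 0" for y
  proof (cases "y = (\<lambda>_. 0)")
    case True
    then show ?thesis by (simp add: nsq_def mv_def)
  next
    case False
    obtain b where b: "b \<noteq> 0" "nsq C (\<lambda>x. b * y x) = 1" "(\<lambda>x. b * y x) \<in> vecs C"
      using normalize_vec[OF fin y(1) False] by blast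
    have "nsq C (mv C A (\<lambda>x. b * y x)) \<le> M"
      unfolding M_def using b y(2) by (intro max) (auto simp: ip_scale_right)
    then have "(cmod b)\<^sup>2 * nsq C (mv C A y) \<le> M"
      by (simp add: mv_scale nsq_scale)
    also have "M = M * ((cmod b)\<^sup>2 * nsq C y)"
      using b(2) by (simp add: nsq_scale)
    finally have "(cmod b)\<^sup>2 * nsq C (mv C A y) \<le> (cmod b)\<^sup>2 * (M * nsq C y)"
      by (simp add: mult_ac)
    moreover have "(cmod b)\<^sup>2 > 0" using b(1) by simp
    ultimately show ?thesis by simp
  qed
  have xv: "x \<in> vecs C" "nsq C x = 1" "\<And>v. v \<in> V \<Longrightarrow> ip C v x = 0"
    using x by auto
  have zv: "z \<in> vecs C" "\<And>v. v \<in> V \<Longrightarrow> ip C v z = 0" "nsq C z = M"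
    using orth_mv xv(3) by (auto simp: z_def mv_vecs M_def)
  \<comment> \<open>Expand the squared norm of \<open>A z - M x\<close>. The cross term is -2 M^2,
    since the inner product of \<open>A z\<close> and \<open>x\<close> is that of \<open>z\<close>
    with itself, and maximality gives at most M^2 for \<open>A z\<close>; the total is at most
    0.\<close>
  have Az: "mv C A z = (\<lambda>i. complex_of_real M * x i)"
  proof -
    let ?u = "\<lambda>i. mv C A z i - complex_of_real M * x i"
    have "ip C (mv C A z) x = ip C z z"
      unfolding z_def by (simp add: ip_mv_herm[OF A])
    then have "Re (ip C (mv C A z) (\<lambda>i. complex_of_real M * x i)) = M * M"
      by (simp add: ip_scale_right ip_self zv(3))
    then have "nsq C ?u = nsq C (mv C A z) - 2 * (M * M) + M\<^sup>2"
      using xv(2) by (simp add: nsq_diff nsq_scale)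
    also have "nsq C (mv C A z) \<le> M * M"
      using bound[OF zv(1,2)] zv(3) by simp
    finally have "nsq C ?u \<le> 0" by (simp add: power2_eq_square)
    then have "nsq C ?u = 0" using nsq_nonneg[of C ?u] by linarith
    moreover have "?u \<in> vecs C" using mv_vecs[of C A z] xv(1) by (simp add: vecs_def)
    ultimately have "?u = (\<lambda>_. 0)" using nsq_zero_iff[OF fin] by blast
    then show ?thesis by (simp add: fun_eq_iff)
  qed
  define m where "m = sqrt M"
  have mm: "complex_of_real M = of_real m * of_real m"
    using M0 by (simp add: m_def flip: of_real_mult)
  define y where "y = (\<lambda>i. z i + of_real m * x i)"
  show ?thesis
  proof (cases "y = (\<lambda>_. 0)")
    case True
    then have "z = (\<lambda>i. of_real (-m) * x i)"
      unfolding y_def by (simp add: fun_eq_iff add_eq_0_iff)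
    then show ?thesis
      using that[of x "-m"] xv by (simp add: z_def)
  next
    case False
    have yv: "y \<in> vecs C" using zv(1) xv(1) by (simp add: y_def vecs_def)
    have yo: "ip C v y = 0" if "v \<in> V" for v
      using that zv(2) xv(3) by (simp add: y_def ip_add_right ip_scale_right)
    have Ay: "mv C A y = (\<lambda>i. of_real m * y i)"
    proof -
      have "mv C A y = (\<lambda>i. mv C A z i + of_real m * mv C A x i)"
        unfolding y_def by (simp add: mv_add mv_scale)
      then show ?thesis
        unfolding Az mm z_def[symmetric] by (simp add: y_def algebra_simps)
    qed
    obtain b where b: "nsq C (\<lambda>x. b * y x) = 1" "(\<lambda>x. b * y x) \<in> vecs C"
      using normalize_vec[OF fin yv False] by blast
    show ?thesis
      using that[of "\<lambda>x. b * y x" m] b yo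
      by (simp add: ip_scale_right mv_scale Ay mult_ac)
  qed
qed

text \<open>The basis vectors index themselves, so degenerate eigenvalues need no bookkeeping.
  Completeness is stated as the expansion formula, which is the form used later.\<close>

definition eigenbasis ::
  "'a set \<Rightarrow> ('a \<Rightarrow> 'a \<Rightarrow> complex) \<Rightarrow> ('a \<Rightarrow> complex) set \<Rightarrow> (('a \<Rightarrow> complex) \<Rightarrow> real) \<Rightarrow> bool" where
  "eigenbasis C A V l \<longleftrightarrow> finite V \<and> orthonormal C V (\<lambda>v. v) \<and>
     (\<forall>v\<in>V. mv C A v = (\<lambda>x. complex_of_real (l v) * v x)) \<and>
     (\<forall>u\<in>vecs C. u = (\<lambda>x. \<Sum>v\<in>V. ip C v u * v x))"

text \<open>Take an orthonormal set of eigenvectors of greatest cardinality. If some vector had a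
  nonzero residual, the orthogonal complement would contain one more unit eigenvector, contradicting
  maximality.\<close>

theorem eigenbasis_exists:
  assumes fin: "finite C" and A: "herm C A"
  obtains V l where "eigenbasis C A V l"
proof -
  define P where "P V \<longleftrightarrow> finite V \<and> orthonormal C V (\<lambda>v. v) \<and>
     (\<forall>v\<in>V. \<exists>l. mv C A v = (\<lambda>x. complex_of_real l * v x))" for V
  have P0: "P {}" by (simp add: P_def orthonormal_def)
  have "\<exists>V. P V \<and> (\<forall>W. P W \<longrightarrow> card W \<le> card V)"
    using P0 orthonormal_card_le[OF fin]
    by (intro ex_has_greatest_nat[of P "{}" card "Suc (card C)"]) (auto simp: P_def less_Suc_eq_le)
  then obtain V where V: "P V" and max: "\<And>W. P W \<Longrightarrow> card W \<le> card V" by blast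
  have finV: "finite V" and oV: "orthonormal C V (\<lambda>v. v)"
    and eV: "\<And>v. v \<in> V \<Longrightarrow> \<exists>l. mv C A v = (\<lambda>x. complex_of_real l * v x)"
    using V by (auto simp: P_def)
  have complete: "u = (\<lambda>x. \<Sum>v\<in>V. ip C v u * v x)" if u: "u \<in> vecs C" for u
  proof (rule ccontr)
    assume "u \<noteq> (\<lambda>x. \<Sum>v\<in>V. ip C v u * v x)"
    then have ne: "resid C V (\<lambda>v. v) u \<noteq> (\<lambda>_. 0)"
      by (auto simp: resid_def fun_eq_iff)
    obtain e l where e: "e \<in> vecs C" "nsq C e = 1" "\<And>v. v \<in> V \<Longrightarrow> ip C v e = 0"
      "mv C A e = (\<lambda>x. complex_of_real l * e x)"
      using orthogonal_eigenvector_exists[OF fin A eV resid_vecs[OF oV u] ne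
          ip_resid[OF finV oV]] by blast
    have enV: "e \<notin> V" using e(2) e(3)[of e] by (auto simp: ip_self)
    have "ip C e v = 0" if "v \<in> V" for v using e(3)[OF that] ip_commute[of C e v] by simp
    then have "P (insert e V)"
      using e enV finV oV eV by (auto simp: P_def orthonormal_def ip_self)
    from max[OF this] show False using enV finV by simp
  qed
  obtain l where "\<forall>v\<in>V. mv C A v = (\<lambda>x. complex_of_real (l v) * v x)"
    using eV by metis
  then have "eigenbasis C A V l"
    using finV oV complete by (auto simp: eigenbasis_def)
  then show ?thesis by (rule that)
qed

section \<open>Gibbs states\<close>

lemma eigenbasisD:
  assumes "eigenbasis C A V l"
  shows "finite V" "orthonormal C V (\<lambda>v. v)"
    "v \<in> V \<Longrightarrow> mv C A v = (\<lambda>x. complex_of_real (l v) * v x)"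
    "u \<in> vecs C \<Longrightarrow> u = (\<lambda>x. \<Sum>v\<in>V. ip C v u * v x)"
    "v \<in> V \<Longrightarrow> v \<in> vecs C" "v \<in> V \<Longrightarrow> nsq C v = 1"
  using assms orthonormal_nsq[of C V "\<lambda>v. v"]
  by (auto simp only: eigenbasis_def orthonormal_def)

text \<open>The resolution of the identity in coordinates, obtained by expanding the unit vector at
  \<open>y\<close>.\<close>

lemma eigenbasis_closure:
  assumes "finite C" "eigenbasis C A V l" "x \<in> C" "y \<in> C"
  shows "(\<Sum>v\<in>V. v x * cnj (v y)) = (if x = y then 1 else 0)"
proof -
  have "unitvec y x = (\<Sum>v\<in>V. ip C v (unitvec y) * v x)"
    by (rule fun_cong[OF eigenbasisD(4)[OF assms(2) unitvec_vecs[OF assms(4)]]])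
  then have "(\<Sum>v\<in>V. v x * cnj (v y)) = unitvec y x"
    by (simp add: ip_unitvec[OF assms(1,4)] mult.commute)
  then show ?thesis by (simp add: unitvec_def)
qed

lemma parseval:
  assumes "eigenbasis C A V l" "u \<in> vecs C"
  shows "(\<Sum>v\<in>V. (cmod (ip C v u))\<^sup>2) = nsq C u"
proof -
  have "resid C V (\<lambda>v. v) u = (\<lambda>_. 0)"
    using eigenbasisD(4)[OF assms] by (auto simp: resid_def fun_eq_iff)
  then show ?thesis
    using nsq_resid[OF eigenbasisD(1,2)[OF assms(1)], of u] by (simp add: nsq_def)
qed

lemma ip_mv_eigenbasis:
  assumes "eigenbasis C A V l" "herm C A" "u \<in> vecs C"
  shows "ip C u (mv C A u) = of_real (\<Sum>v\<in>V. l v * (cmod (ip C v u))\<^sup>2)"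
proof -
  have "ip C u (mv C A u) = ip C (mv C A u) u" by (rule ip_mv_herm[OF assms(2)])
  also have "\<dots> = ip C (mv C A u) (\<lambda>x. \<Sum>v\<in>V. ip C v u * v x)"
    using eigenbasisD(4)[OF assms(1,3)] by simp
  also have "\<dots> = (\<Sum>v\<in>V. ip C v u * ip C (mv C A u) v)"
    by (rule ip_sum_right)
  also have "\<dots> = (\<Sum>v\<in>V. of_real (l v * (cmod (ip C v u))\<^sup>2))"
  proof (intro sum.cong refl)
    fix v assume v: "v \<in> V"
    have "ip C (mv C A u) v = of_real (l v) * ip C u v"
      by (simp add: ip_mv_herm[OF assms(2), symmetric] eigenbasisD(3)[OF assms(1) v] ip_scale_right)
    also have "ip C u v = cnj (ip C v u)" by (rule ip_commute)
    finally show "ip C v u * ip C (mv C A u) v = of_real (l v * (cmod (ip C v u))\<^sup>2)"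
      by (simp add: complex_norm_square mult_ac del: of_real_power)
  qed
  finally show ?thesis by simp
qed

text \<open>The exponent carries no minus sign: \<open>a\<close> will hold the eigenvalues of
  -\<beta>H, so lower bounds on averages of \<open>a\<close> are upper bounds on the energy.\<close>

definition gibbs :: "'i set \<Rightarrow> ('i \<Rightarrow> real) \<Rightarrow> 'i \<Rightarrow> real" where
  "gibbs V a v = exp (a v) / (\<Sum>u\<in>V. exp (a u))"

lemma gibbs_pos: "finite V \<Longrightarrow> v \<in> V \<Longrightarrow> gibbs V a v > 0"
  unfolding gibbs_def by (intro divide_pos_pos sum_pos) auto

lemma gibbs_sum: "finite V \<Longrightarrow> V \<noteq> {} \<Longrightarrow> (\<Sum>v\<in>V. gibbs V a v) = 1"
  unfolding gibbs_def sum_divide_distrib[symmetric]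
  by (metis div_self exp_gt_zero less_irrefl sum_pos)

text \<open>The trial state has weights \<open>p v / K \<le> 1 / K\<close>, hence entropy at least \<open>ln K\<close>.\<close>

lemma gibbs_variational:
  fixes a p :: "'i \<Rightarrow> real"
  assumes fin: "finite V" and K: "K > 0" and n: "real (card V) \<le> n"
    and p: "\<And>v. v \<in> V \<Longrightarrow> 0 \<le> p v" "\<And>v. v \<in> V \<Longrightarrow> p v \<le> 1" "(\<Sum>v\<in>V. p v) = K"
  shows "(\<Sum>v\<in>V. gibbs V a v * a v) \<ge> (\<Sum>v\<in>V. p v * a v) / K - ln (n / K)"
proof -
  define Z where "Z = (\<Sum>u\<in>V. exp (a u))"
  define w where "w = gibbs V a"
  define q where "q v = p v / K" for v
  have ne: "V \<noteq> {}" using p(3) K by auto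
  have Z: "Z > 0" unfolding Z_def using fin ne by (intro sum_pos) auto
  have wpos: "w v > 0" if "v \<in> V" for v using that fin by (simp add: w_def gibbs_pos)
  have wsum: "(\<Sum>v\<in>V. w v) = 1" unfolding w_def using fin ne by (rule gibbs_sum)
  have qsum: "(\<Sum>v\<in>V. q v) = 1"
    unfolding q_def sum_divide_distrib[symmetric] using p(3) K by simp
  have npos: "n > 0" using n fin ne by (metis card_gt_0_iff less_le_trans of_nat_0_less_iff)
  have a: "a v = ln (w v) + ln Z" if "v \<in> V" for v
    using Z by (simp add: w_def gibbs_def Z_def[symmetric] ln_div)
  \<comment> \<open>ln t \<le> t - 1 at t = 1/(w n). Summed over \<open>V\<close>, this says that
    the Gibbs entropy is at most ln n.\<close>
  have low: "w v * ln (w v) \<ge> w v - 1 / n - w v * ln n" if "v \<in> V" for v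
  proof -
    have wn: "w v * n > 0" using wpos[OF that] npos by simp
    have "ln (1 / (w v * n)) \<le> 1 / (w v * n) - 1"
      using wn by (intro ln_le_minus_one) simp
    then have "ln (w v) \<ge> 1 - 1 / (w v * n) - ln n"
      using wn wpos[OF that] npos by (simp add: ln_div ln_mult)
    then have "w v * ln (w v) \<ge> w v * (1 - 1 / (w v * n) - ln n)"
      using wpos[OF that] by (intro mult_left_mono) auto
    also have "w v * (1 - 1 / (w v * n) - ln n) = w v - 1 / n - w v * ln n"
      using wpos[OF that] npos by (simp add: field_simps)
    finally show ?thesis .
  qed
  \<comment> \<open>The same inequality at t = w/q is the nonnegativity of relative entropy. Since q
    K = p \<le> 1, ln q may be replaced by -ln K. A vanishing weight q is separated because of the
    division by it.\<close>
  have up: "q v * ln (w v) \<le> w v - q v - q v * ln K" if "v \<in> V" for v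
  proof (cases "q v = 0")
    case True
    then show ?thesis using wpos[OF that] by simp
  next
    case False
    then have q: "q v > 0" using p(1)[OF that] K by (simp add: q_def less_le)
    have "ln (w v / q v) \<le> w v / q v - 1"
      using q wpos[OF that] by (intro ln_le_minus_one) simp
    moreover have "ln (q v * K) \<le> 0" using p(2)[OF that] q K by (simp add: q_def zero_less_divide_iff)
    ultimately have "ln (w v) \<le> w v / q v - 1 - ln K"
      using q K wpos[OF that] by (simp add: ln_div ln_mult)
    then have "q v * ln (w v) \<le> q v * (w v / q v - 1 - ln K)"
      using q by (intro mult_left_mono) auto
    also have "\<dots> = w v - q v - q v * ln K" using q by (simp add: field_simps)
    finally show ?thesis .
  qed
  have "(\<Sum>v\<in>V. w v * a v) - (\<Sum>v\<in>V. q v * a v)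
      = (\<Sum>v\<in>V. w v * ln (w v) + w v * ln Z) - (\<Sum>v\<in>V. q v * ln (w v) + q v * ln Z)"
    by (intro arg_cong2[where f = "(-)"] sum.cong refl) (simp_all add: a distrib_left)
  also have "\<dots> = (\<Sum>v\<in>V. w v * ln (w v)) - (\<Sum>v\<in>V. q v * ln (w v))"
    by (simp add: sum.distrib sum_distrib_right[symmetric] wsum qsum)
  also have "\<dots> \<ge> (\<Sum>v\<in>V. w v - 1 / n - w v * ln n) - (\<Sum>v\<in>V. w v - q v - q v * ln K)"
    by (intro diff_mono sum_mono low up)
  also have "(\<Sum>v\<in>V. w v - 1 / n - w v * ln n) = 1 - card V / n - ln n"
    by (simp add: sum_subtractf sum_distrib_right[symmetric] wsum)
  also have "(\<Sum>v\<in>V. w v - q v - q v * ln K) = - ln K"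
    by (simp add: sum_subtractf sum_distrib_right[symmetric] wsum qsum)
  finally have "(\<Sum>v\<in>V. w v * a v) - (\<Sum>v\<in>V. q v * a v) \<ge> 1 - card V / n - ln n + ln K"
    by simp
  moreover have "card V / n \<le> 1" using n npos by simp
  moreover have "ln (n / K) = ln n - ln K" using npos K by (simp add: ln_div)
  moreover have "(\<Sum>v\<in>V. q v * a v) = (\<Sum>v\<in>V. p v * a v) / K"
    by (simp add: q_def sum_divide_distrib)
  ultimately show ?thesis unfolding w_def by linarith
qed

text \<open>The trial state is the projection onto the span of the \<open>f m\<close>, divided by
  its rank. Only its diagonal in the eigenbasis enters: the weights \<open>p v\<close> are at most 1
  by Bessel and sum to \<open>card M\<close> by Parseval, so the classical variational inequality
  applies.\<close>

lemma gibbs_energy_lower_bound: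
  assumes fin: "finite C" and A: "herm C A" and E: "eigenbasis C A V l"
    and M: "finite M" "M \<noteq> {}" "orthonormal C M f"
    and e: "\<And>m. m \<in> M \<Longrightarrow> Re (ip C (f m) (mv C A (f m))) \<ge> e"
  shows "(\<Sum>v\<in>V. gibbs V l v * l v) \<ge> e - ln (card C / card M)"
proof -
  define p where "p v = (\<Sum>m\<in>M. (cmod (ip C v (f m)))\<^sup>2)" for v
  have fv: "f m \<in> vecs C" if "m \<in> M" for m using M(3) that by (simp add: orthonormal_def)
  have K: "real (card M) > 0" using M by (simp add: card_gt_0_iff)
  have p1: "p v \<le> 1" if "v \<in> V" for v
  proof -
    have "p v = (\<Sum>m\<in>M. (cmod (ip C (f m) v))\<^sup>2)"
      unfolding p_def by (subst ip_commute) simp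
    also have "\<dots> \<le> nsq C v" by (rule bessel[OF M(1,3)])
    also have "\<dots> = 1" by (rule eigenbasisD(6)[OF E that])
    finally show ?thesis .
  qed
  have "(\<Sum>v\<in>V. p v) = (\<Sum>m\<in>M. \<Sum>v\<in>V. (cmod (ip C v (f m)))\<^sup>2)"
    unfolding p_def by (rule sum.swap)
  also have "\<dots> = (\<Sum>m\<in>M. 1)"
    by (intro sum.cong refl) (simp add: parseval[OF E fv] orthonormal_nsq[OF M(3)])
  finally have psum: "(\<Sum>v\<in>V. p v) = card M" by simp
  have "(\<Sum>v\<in>V. p v * l v) = (\<Sum>v\<in>V. \<Sum>m\<in>M. l v * (cmod (ip C v (f m)))\<^sup>2)"
    unfolding p_def by (simp add: sum_distrib_left sum_distrib_right mult_ac)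
  also have "\<dots> = (\<Sum>m\<in>M. \<Sum>v\<in>V. l v * (cmod (ip C v (f m)))\<^sup>2)"
    by (rule sum.swap)
  also have "\<dots> = (\<Sum>m\<in>M. Re (ip C (f m) (mv C A (f m))))"
    by (intro sum.cong refl) (simp add: ip_mv_eigenbasis[OF E A fv])
  also have "\<dots> \<ge> (\<Sum>m\<in>M. e)" by (intro sum_mono e)
  finally have "(\<Sum>v\<in>V. p v * l v) / card M \<ge> e"
    using K by (simp add: field_simps)
  moreover have "real (card V) \<le> real (card C)"
    using orthonormal_card_le[OF fin eigenbasisD(1,2)[OF E]] by simp
  from gibbs_variational[OF eigenbasisD(1)[OF E] K this _ p1 psum, of l]
  have "(\<Sum>v\<in>V. gibbs V l v * l v) \<ge> (\<Sum>v\<in>V. p v * l v) / card M - ln (card C / card M)"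
    by (simp add: p_def sum_nonneg)
  ultimately show ?thesis by linarith
qed

section \<open>Counting configurations and the thermal average in an eigenbasis\<close>

lemma torus_finite: "finite (torus N)"
  by (simp add: torus_def)

text \<open>These configurations serve as labels of joint eigenvectors of the dominant component;
  they stand for spin values near the top also when that component is \<open>CX\<close>.\<close>

definition topconfs :: "nat \<Rightarrow> nat \<Rightarrow> nat \<Rightarrow> conf set" where
  "topconfs N d k = {\<sigma> \<in> confs N d. \<forall>r\<in>torus N. k \<le> \<sigma> r}"

text \<open>Configurations are 0 off the torus, members of the product set are
  \<open>undefined\<close> there; the two maps exchange these default values.\<close>

lemma bij_betw_topconfs_PiE:
  "bij_betw (\<lambda>\<sigma>. restrict \<sigma> (torus N)) (topconfs N d k) (torus N \<rightarrow>\<^sub>E {k..d})"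
proof (rule bij_betw_byWitness[where f' = "\<lambda>f r. if r \<in> torus N then f r else 0"])
  show "(\<lambda>\<sigma>. restrict \<sigma> (torus N)) ` topconfs N d k \<subseteq> torus N \<rightarrow>\<^sub>E {k..d}"
    by (auto simp: topconfs_def confs_def)
  show "(\<lambda>f r. if r \<in> torus N then f r else 0) ` (torus N \<rightarrow>\<^sub>E {k..d}) \<subseteq> topconfs N d k"
    by (auto simp: topconfs_def confs_def PiE_iff)
qed (auto simp: topconfs_def confs_def fun_eq_iff PiE_iff extensional_def)

lemma card_topconfs: "card (topconfs N d k) = (Suc d - k) ^ (N * N)"
  using bij_betw_same_card[OF bij_betw_topconfs_PiE[of N d k]]
  by (simp add: card_PiE torus_finite) (simp add: torus_def card_cartesian_product)

lemma topconfs_0: "topconfs N d 0 = confs N d"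
  by (auto simp: topconfs_def)

lemma confs_finite: "finite (confs N d)"
  using bij_betw_finite[OF bij_betw_topconfs_PiE[of N d 0]]
  by (simp add: topconfs_0 finite_PiE torus_finite)

lemma card_confs: "card (confs N d) = Suc d ^ (N * N)"
  using card_topconfs[of N d 0] by (simp add: topconfs_0)

lemma mv_opmul: "mv (confs N d) (opmul N d A B) v = mv (confs N d) A (mv (confs N d) B v)"
proof
  fix x
  have "(\<Sum>y\<in>confs N d. (\<Sum>z\<in>confs N d. A x z * B z y) * v y)
      = (\<Sum>y\<in>confs N d. \<Sum>z\<in>confs N d. A x z * (B z y * v y))"
    by (simp add: sum_distrib_right mult.assoc)
  also have "\<dots> = (\<Sum>z\<in>confs N d. \<Sum>y\<in>confs N d. A x z * (B z y * v y))"
    by (rule sum.swap)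
  finally show "mv (confs N d) (opmul N d A B) v x = mv (confs N d) A (mv (confs N d) B v) x"
    by (simp add: mv_def opmul_def sum_distrib_left)
qed

text \<open>The case k = 0 is the resolution of the identity. It holds on \<open>confs\<close> only,
  whereas \<open>opid\<close> has ones on the diagonal everywhere, hence the restriction of both
  indices.\<close>

lemma oppow_eigenbasis:
  assumes E: "eigenbasis (confs N d) A V l" and "\<sigma> \<in> confs N d" "\<tau> \<in> confs N d"
  shows "oppow N d A k \<sigma> \<tau> = (\<Sum>v\<in>V. of_real (l v) ^ k * (v \<sigma> * cnj (v \<tau>)))"
  using assms(2)
proof (induction k arbitrary: \<sigma>)
  case 0
  then show ?case
    using eigenbasis_closure[OF confs_finite E 0 assms(3)] by (simp add: opid_def)
next
  case (Suc k)
  have "oppow N d A (Suc k) \<sigma> \<tau>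
      = (\<Sum>\<rho>\<in>confs N d. \<Sum>v\<in>V. of_real (l v) ^ k * cnj (v \<tau>) * (A \<sigma> \<rho> * v \<rho>))"
    by (simp add: opmul_def Suc.IH sum_distrib_left mult_ac)
  also have "\<dots> = (\<Sum>v\<in>V. \<Sum>\<rho>\<in>confs N d. of_real (l v) ^ k * cnj (v \<tau>) * (A \<sigma> \<rho> * v \<rho>))"
    by (rule sum.swap)
  also have "\<dots> = (\<Sum>v\<in>V. of_real (l v) ^ k * cnj (v \<tau>) * mv (confs N d) A v \<sigma>)"
    using Suc.prems by (simp add: mv_def sum_distrib_left)
  also have "\<dots> = (\<Sum>v\<in>V. of_real (l v) ^ Suc k * (v \<sigma> * cnj (v \<tau>)))"
    by (intro sum.cong refl) (simp add: eigenbasisD(3)[OF E] mult_ac)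
  finally show ?case .
qed

text \<open>\<open>opexp\<close> is an entrywise power series. The spectral form of the powers makes
  it a finite combination of scalar exponential series, so convergence comes from the scalar
  case.\<close>

lemma opexp_eigenbasis:
  assumes E: "eigenbasis (confs N d) A V l" and "\<sigma> \<in> confs N d" "\<tau> \<in> confs N d"
  shows "opexp N d A \<sigma> \<tau> = (\<Sum>v\<in>V. of_real (exp (l v)) * (v \<sigma> * cnj (v \<tau>)))"
proof -
  have "(\<lambda>k. \<Sum>v\<in>V. of_real (l v) ^ k / of_nat (fact k) * (v \<sigma> * cnj (v \<tau>)))
      sums (\<Sum>v\<in>V. exp (of_real (l v)) * (v \<sigma> * cnj (v \<tau>)))"
  proof (intro sums_sum sums_mult2)
    fix v :: "conf \<Rightarrow> complex"
    show "(\<lambda>k. complex_of_real (l v) ^ k / of_nat (fact k)) sums exp (of_real (l v))"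
      using exp_converges[of "complex_of_real (l v)"]
      by (simp add: scaleR_conv_of_real divide_inverse mult.commute)
  qed
  moreover have "(\<Sum>v\<in>V. of_real (l v) ^ k / of_nat (fact k) * (v \<sigma> * cnj (v \<tau>)))
      = oppow N d A k \<sigma> \<tau> / of_nat (fact k)" for k
    by (simp add: oppow_eigenbasis[OF assms] sum_divide_distrib)
  ultimately show ?thesis
    unfolding opexp_def by (simp add: sums_iff exp_of_real)
qed

lemma optrace_opmul_opexp:
  assumes E: "eigenbasis (confs N d) A V l"
  shows "optrace N d (opmul N d B (opexp N d A))
    = (\<Sum>v\<in>V. of_real (exp (l v)) * ip (confs N d) v (mv (confs N d) B v))"
proof -
  have "optrace N d (opmul N d B (opexp N d A))
     = (\<Sum>\<sigma>\<in>confs N d. \<Sum>\<rho>\<in>confs N d. \<Sum>v\<in>V. of_real (exp (l v)) * (cnj (v \<sigma>) * (B \<sigma> \<rho> * v \<rho>)))"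
    by (simp add: optrace_def opmul_def opexp_eigenbasis[OF E] sum_distrib_left mult_ac)
  also have "\<dots> = (\<Sum>\<sigma>\<in>confs N d. \<Sum>v\<in>V. \<Sum>\<rho>\<in>confs N d. of_real (exp (l v)) * (cnj (v \<sigma>) * (B \<sigma> \<rho> * v \<rho>)))"
    by (intro sum.cong refl sum.swap)
  also have "\<dots> = (\<Sum>v\<in>V. \<Sum>\<sigma>\<in>confs N d. \<Sum>\<rho>\<in>confs N d. of_real (exp (l v)) * (cnj (v \<sigma>) * (B \<sigma> \<rho> * v \<rho>)))"
    by (rule sum.swap)
  also have "\<dots> = (\<Sum>v\<in>V. of_real (exp (l v)) * ip (confs N d) v (mv (confs N d) B v))"
    by (simp add: ip_def mv_def sum_distrib_left)
  finally show ?thesis .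
qed

lemma optrace_opexp:
  assumes E: "eigenbasis (confs N d) A V l"
  shows "optrace N d (opexp N d A) = of_real (\<Sum>v\<in>V. exp (l v))"
proof -
  have "optrace N d (opexp N d A) = (\<Sum>\<sigma>\<in>confs N d. \<Sum>v\<in>V. of_real (exp (l v)) * (cnj (v \<sigma>) * v \<sigma>))"
    by (simp add: optrace_def opexp_eigenbasis[OF E] mult_ac)
  also have "\<dots> = (\<Sum>v\<in>V. \<Sum>\<sigma>\<in>confs N d. of_real (exp (l v)) * (cnj (v \<sigma>) * v \<sigma>))"
    by (rule sum.swap)
  also have "\<dots> = (\<Sum>v\<in>V. of_real (exp (l v)) * ip (confs N d) v v)"
    by (simp add: ip_def sum_distrib_left)
  also have "\<dots> = (\<Sum>v\<in>V. of_real (exp (l v)))"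
    by (intro sum.cong refl) (simp add: ip_self eigenbasisD(6)[OF E])
  finally show ?thesis by simp
qed

definition negbH :: "nat \<Rightarrow> nat \<Rightarrow> real \<Rightarrow> real \<Rightarrow> real \<Rightarrow> qop" where
  "negbH N d J1 J2 \<beta> = (\<lambda>\<sigma> \<tau>. - complex_of_real \<beta> * ham N d J1 J2 \<sigma> \<tau>)"

text \<open>All estimates use this form, a convex combination of quadratic forms in eigenvectors.
  Translation invariance is the one place that works with the operator exponential itself.\<close>

lemma Re_thermal:
  assumes E: "eigenbasis (confs N d) (negbH N d J1 J2 \<beta>) V l"
  shows "Re (thermal N d J1 J2 \<beta> B)
    = (\<Sum>v\<in>V. gibbs V l v * Re (ip (confs N d) v (mv (confs N d) B v)))"
proof -
  have "thermal N d J1 J2 \<beta> B = (\<Sum>v\<in>V. of_real (gibbs V l v) * ip (confs N d) v (mv (confs N d) B v))"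
    unfolding thermal_def Let_def negbH_def[symmetric] optrace_opmul_opexp[OF E] optrace_opexp[OF E]
    by (simp add: gibbs_def sum_divide_distrib)
  then show ?thesis by simp
qed

section \<open>Spin operators\<close>

declare split_paired_All [simp del] split_paired_Ex [simp del]

text \<open>The matrix element between the labels s-1 and s: with M = s - 1 - d/2 one has S(S+1) -
  M(M+1) = s(d+1-s). It vanishes at s = 0 and s = d+1, which takes care of both ends of the
  spectrum.\<close>

definition ladder :: "nat \<Rightarrow> nat \<Rightarrow> real" where
  "ladder d s = sqrt (real s * (real d + 1 - real s))"

lemma ladder_0 [simp]: "ladder d 0 = 0"
  by (simp add: ladder_def)

lemma ladder_top [simp]: "ladder d (Suc d) = 0"
  by (simp add: ladder_def)

lemma confs_le: "\<sigma> \<in> confs N d \<Longrightarrow> r \<in> torus N \<Longrightarrow> \<sigma> r \<le> d"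
  by (auto simp: confs_def)

lemma confs_upd: "\<sigma> \<in> confs N d \<Longrightarrow> r \<in> torus N \<Longrightarrow> s \<le> d \<Longrightarrow> \<sigma>(r := s) \<in> confs N d"
  by (auto simp: confs_def)

text \<open>The formula holds for every function \<sigma>, not only on \<open>confs\<close>, so it
  can be composed freely. Truncated subtraction at 0 is harmless because \<open>ladder d 0\<close>
  vanishes. If lowering brings an outside \<sigma> into \<open>confs\<close>, its value at
  \<open>r\<close> was d+1, where \<open>ladder\<close> vanishes as well.\<close>

lemma mv_Splus:
  assumes r: "r \<in> torus N" and v: "v \<in> vecs (confs N d)"
  shows "mv (confs N d) (Splus d r) v = (\<lambda>\<sigma>. of_real (ladder d (\<sigma> r)) * v (\<sigma>(r := \<sigma> r - 1)))"
proof
  fix \<sigma>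
  show "mv (confs N d) (Splus d r) v \<sigma> = of_real (ladder d (\<sigma> r)) * v (\<sigma>(r := \<sigma> r - 1))"
  proof (cases "\<sigma> \<in> confs N d")
    case False
    have "ladder d (\<sigma> r) = 0" if "\<sigma>(r := \<sigma> r - 1) \<in> confs N d"
    proof -
      have "\<sigma> r - 1 \<le> d" using confs_le[OF that r] by simp
      moreover have "\<not> \<sigma> r \<le> d"
        using False confs_upd[OF that r, of "\<sigma> r"] by auto
      ultimately have "\<sigma> r = Suc d" by linarith
      then show ?thesis by simp
    qed
    then show ?thesis
      using False v by (auto simp: mv_def vecs_def)
  next
    case True
    note le = confs_le[OF True r]
    show ?thesis
    proof (cases "\<sigma> r")
      case 0
      then have "Splus d r \<sigma> \<tau> = 0" for \<tau>
        by (auto simp: Splus_def)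
      then show ?thesis using 0 by (simp add: mv_def)
    next
      case (Suc t)
      let ?\<rho> = "\<sigma>(r := t)"
      have iff: "(\<tau> r < d \<and> \<sigma> = \<tau>(r := Suc (\<tau> r))) \<longleftrightarrow> \<tau> = ?\<rho>" for \<tau>
        using Suc le by (auto simp: fun_eq_iff)
      have \<rho>: "?\<rho> \<in> confs N d" using True r Suc le by (intro confs_upd) auto
      have "mv (confs N d) (Splus d r) v \<sigma>
        = (\<Sum>\<tau>\<in>confs N d. if \<tau> = ?\<rho> then of_real (ladder d (\<sigma> r)) * v \<tau> else 0)"
        using True Suc
        by (auto simp: mv_def Splus_def iff ladder_def spinS_def Mval_def field_simps
            intro!: sum.cong)
      then show ?thesis using \<rho> Suc by (simp add: confs_finite)
    qed
  qed
qed

lemma mv_Sminus: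
  assumes r: "r \<in> torus N" and v: "v \<in> vecs (confs N d)"
  shows "mv (confs N d) (Sminus d r) v = (\<lambda>\<sigma>. of_real (ladder d (Suc (\<sigma> r))) * v (\<sigma>(r := Suc (\<sigma> r))))"
proof
  fix \<sigma>
  show "mv (confs N d) (Sminus d r) v \<sigma> = of_real (ladder d (Suc (\<sigma> r))) * v (\<sigma>(r := Suc (\<sigma> r)))"
  proof (cases "\<sigma> \<in> confs N d")
    case False
    have "\<sigma>(r := Suc (\<sigma> r)) \<notin> confs N d"
    proof
      assume *: "\<sigma>(r := Suc (\<sigma> r)) \<in> confs N d"
      then have "\<sigma> r \<le> d" using confs_le[OF * r] by simp
      then show False using False confs_upd[OF * r, of "\<sigma> r"] by simp
    qed
    then show ?thesis
      using False v by (auto simp: mv_def vecs_def)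
  next
    case True
    note le = confs_le[OF True r]
    let ?\<rho> = "\<sigma>(r := Suc (\<sigma> r))"
    have iff: "(0 < \<tau> r \<and> \<sigma> = \<tau>(r := \<tau> r - 1)) \<longleftrightarrow> \<tau> = ?\<rho>" for \<tau>
      by (auto simp: fun_eq_iff)
    have "mv (confs N d) (Sminus d r) v \<sigma>
      = (\<Sum>\<tau>\<in>confs N d. if \<tau> = ?\<rho> then of_real (ladder d (Suc (\<sigma> r))) * v \<tau> else 0)"
      using True
      by (auto simp: mv_def Sminus_def iff ladder_def spinS_def Mval_def field_simps
          intro!: sum.cong)
    then show ?thesis using v by (auto simp: confs_finite vecs_def)
  qed
qed

lemma mv_Sz:
  assumes v: "v \<in> vecs (confs N d)"
  shows "mv (confs N d) (spin d CZ r) v = (\<lambda>\<sigma>. of_real (Mval d (\<sigma> r)) * v \<sigma>)"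
proof
  fix \<sigma>
  have "(\<Sum>\<tau>\<in>confs N d. Sz d r \<sigma> \<tau> * v \<tau>)
      = (\<Sum>\<tau>\<in>confs N d. if \<sigma> = \<tau> then of_real (Mval d (\<tau> r)) * v \<tau> else 0)"
    by (intro sum.cong refl) (simp add: Sz_def)
  then show "mv (confs N d) (spin d CZ r) v \<sigma> = of_real (Mval d (\<sigma> r)) * v \<sigma>"
    using v by (simp add: mv_def spin_def confs_finite vecs_def)
qed

lemma mv_lincomb:
  "mv C (\<lambda>x y. a * A x y + b * B x y) v = (\<lambda>x. a * mv C A v x + b * mv C B v x)"
  by (rule ext) (simp add: mv_def distrib_right sum.distrib sum_distrib_left mult.assoc)

lemma mv_Sx: "mv C (spin d CX r) v = (\<lambda>\<sigma>. (mv C (Splus d r) v \<sigma> + mv C (Sminus d r) v \<sigma>) / 2)"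
proof -
  have "spin d CX r = (\<lambda>\<sigma> \<tau>. 1 / 2 * Splus d r \<sigma> \<tau> + 1 / 2 * Sminus d r \<sigma> \<tau>)"
    by (intro ext) (simp add: spin_def Sx_def field_simps)
  then show ?thesis by (simp only: mv_lincomb) (simp add: field_simps)
qed

lemma mv_Sy: "mv C (spin d CY r) v
  = (\<lambda>\<sigma>. - \<i> / 2 * (mv C (Splus d r) v \<sigma> - mv C (Sminus d r) v \<sigma>))"
proof -
  have "spin d CY r = (\<lambda>\<sigma> \<tau>. (- \<i> / 2) * Splus d r \<sigma> \<tau> + (\<i> / 2) * Sminus d r \<sigma> \<tau>)"
    by (intro ext) (simp add: spin_def Sy_def field_simps)
  then show ?thesis by (simp only: mv_lincomb) (simp add: right_diff_distrib diff_divide_distrib)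
qed

text \<open>\<open>lo\<close>, \<open>md\<close> and \<open>hi\<close> are the coefficients of one
  tridiagonal formula valid for all three components, so that facts such as commutation at distinct
  sites are proved once rather than for each pair of components.\<close>

definition lo :: "nat \<Rightarrow> comp \<Rightarrow> nat \<Rightarrow> complex" where
  "lo d a s = (case a of CX \<Rightarrow> of_real (ladder d s) / 2
    | CY \<Rightarrow> - \<i> / 2 * of_real (ladder d s) | CZ \<Rightarrow> 0)"

definition md :: "nat \<Rightarrow> comp \<Rightarrow> nat \<Rightarrow> complex" where
  "md d a s = (case a of CZ \<Rightarrow> of_real (Mval d s) | _ \<Rightarrow> 0)"

definition hi :: "nat \<Rightarrow> comp \<Rightarrow> nat \<Rightarrow> complex" where
  "hi d a s = (case a of CX \<Rightarrow> of_real (ladder d (Suc s)) / 2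
    | CY \<Rightarrow> \<i> / 2 * of_real (ladder d (Suc s)) | CZ \<Rightarrow> 0)"

lemma mv_spin:
  assumes "r \<in> torus N" "v \<in> vecs (confs N d)"
  shows "mv (confs N d) (spin d a r) v = (\<lambda>\<sigma>. lo d a (\<sigma> r) * v (\<sigma>(r := \<sigma> r - 1))
    + md d a (\<sigma> r) * v \<sigma> + hi d a (\<sigma> r) * v (\<sigma>(r := Suc (\<sigma> r))))"
  by (cases a) (simp_all add: mv_Sx mv_Sy mv_Sz[OF assms(2)] mv_Splus[OF assms] mv_Sminus[OF assms]
      lo_def md_def hi_def fun_eq_iff algebra_simps add_divide_distrib diff_divide_distrib)

text \<open>Each coefficient reads only the value at its own site, and updates at distinct sites
  commute.\<close>

lemma spin_commute:
  assumes r: "r \<in> torus N" "r' \<in> torus N" "r \<noteq> r'" and v: "v \<in> vecs (confs N d)"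
  shows "mv (confs N d) (spin d a r) (mv (confs N d) (spin d b r') v)
    = mv (confs N d) (spin d b r') (mv (confs N d) (spin d a r) v)"
  unfolding mv_spin[OF r(1) mv_vecs] mv_spin[OF r(2) mv_vecs]
  unfolding mv_spin[OF r(1) v] mv_spin[OF r(2) v]
  using r(3) by (intro ext) (simp add: fun_upd_twist[OF r(3)] algebra_simps)

lemma ladder_sq: "s \<le> Suc d \<Longrightarrow> ladder d s * ladder d s = real s * (real d + 1 - real s)"
  unfolding ladder_def by (intro real_sqrt_mult_self[THEN trans]) simp

lemma Splus_Sminus:
  assumes r: "r \<in> torus N" and v: "v \<in> vecs (confs N d)"
  shows "mv (confs N d) (Splus d r) (mv (confs N d) (Sminus d r) v)
    = (\<lambda>\<sigma>. of_real (real (\<sigma> r) * (real d + 1 - real (\<sigma> r))) * v \<sigma>)"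
proof
  fix \<sigma>
  show "mv (confs N d) (Splus d r) (mv (confs N d) (Sminus d r) v) \<sigma>
    = of_real (real (\<sigma> r) * (real d + 1 - real (\<sigma> r))) * v \<sigma>"
  proof (cases "\<sigma> \<in> confs N d")
    case True
    then have le: "\<sigma> r \<le> Suc d" using confs_le[OF True r] by simp
    show ?thesis
    proof (cases "\<sigma> r")
      case (Suc t)
      then have "\<sigma>(r := Suc t) = \<sigma>" by auto
      then show ?thesis
        using Suc unfolding mv_Splus[OF r mv_vecs] ladder_sq[OF le, symmetric]
        by (simp add: mv_Sminus[OF r v])
    qed (simp add: mv_Splus[OF r mv_vecs])
  qed (use v in \<open>simp add: mv_def vecs_def\<close>)
qed

lemma Sminus_Splus:
  assumes r: "r \<in> torus N" and v: "v \<in> vecs (confs N d)"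
  shows "mv (confs N d) (Sminus d r) (mv (confs N d) (Splus d r) v)
    = (\<lambda>\<sigma>. of_real ((real (\<sigma> r) + 1) * (real d - real (\<sigma> r))) * v \<sigma>)"
proof
  fix \<sigma>
  show "mv (confs N d) (Sminus d r) (mv (confs N d) (Splus d r) v) \<sigma>
    = of_real ((real (\<sigma> r) + 1) * (real d - real (\<sigma> r))) * v \<sigma>"
  proof (cases "\<sigma> \<in> confs N d")
    case True
    then have le: "Suc (\<sigma> r) \<le> Suc d" using confs_le[OF True r] by simp
    have "(real (\<sigma> r) + 1) * (real d - real (\<sigma> r)) = ladder d (Suc (\<sigma> r)) * ladder d (Suc (\<sigma> r))"
      using ladder_sq[OF le] by (simp add: algebra_simps)
    then show ?thesis
      unfolding mv_Sminus[OF r mv_vecs] by (simp add: mv_Splus[OF r v])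
  qed (use v in \<open>simp add: mv_def vecs_def\<close>)
qed

lemma mv_divide: "mv C A (\<lambda>x. v x / c) = (\<lambda>x. mv C A v x / c)"
  using mv_scale[of C A "1 / c" v] by simp

text \<open>In X^2 + Y^2 the squares of the raising and lowering operators cancel, leaving half of
  their anticommutator, which is diagonal.\<close>

lemma casimir:
  assumes r: "r \<in> torus N" and v: "v \<in> vecs (confs N d)"
  shows "mv (confs N d) (spin d CX r) (mv (confs N d) (spin d CX r) v) \<sigma>
    + mv (confs N d) (spin d CY r) (mv (confs N d) (spin d CY r) v) \<sigma>
    + mv (confs N d) (spin d CZ r) (mv (confs N d) (spin d CZ r) v) \<sigma>
    = of_real (spinS d * (spinS d + 1)) * v \<sigma>"
proof -
  let ?P = "mv (confs N d) (Splus d r)" and ?Q = "mv (confs N d) (Sminus d r)"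
  have X: "mv (confs N d) (spin d CX r) (mv (confs N d) (spin d CX r) v) \<sigma>
     = (?P (?P v) \<sigma> + ?P (?Q v) \<sigma> + ?Q (?P v) \<sigma> + ?Q (?Q v) \<sigma>) / 4"
    by (simp add: mv_Sx mv_add mv_divide add_divide_distrib)
  have Y: "mv (confs N d) (spin d CY r) (mv (confs N d) (spin d CY r) v) \<sigma>
     = - (?P (?P v) \<sigma> - ?P (?Q v) \<sigma> - ?Q (?P v) \<sigma> + ?Q (?Q v) \<sigma>) / 4"
    by (simp only: mv_Sy mv_diff mv_scale) (simp add: field_simps)
  have Z: "mv (confs N d) (spin d CZ r) (mv (confs N d) (spin d CZ r) v) \<sigma>
     = of_real (Mval d (\<sigma> r) * Mval d (\<sigma> r)) * v \<sigma>"
    unfolding mv_Sz[OF mv_vecs] unfolding mv_Sz[OF v] by simp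
  have "(?P (?Q v) \<sigma> + ?Q (?P v) \<sigma>) / 2 + of_real (Mval d (\<sigma> r) * Mval d (\<sigma> r)) * v \<sigma>
    = of_real ((real (\<sigma> r) * (real d + 1 - real (\<sigma> r)) + (real (\<sigma> r) + 1) * (real d - real (\<sigma> r))) / 2
        + Mval d (\<sigma> r) * Mval d (\<sigma> r)) * v \<sigma>"
    unfolding Splus_Sminus[OF r v] Sminus_Splus[OF r v]
    by (simp add: algebra_simps add_divide_distrib)
  also have "(real (\<sigma> r) * (real d + 1 - real (\<sigma> r)) + (real (\<sigma> r) + 1) * (real d - real (\<sigma> r))) / 2
        + Mval d (\<sigma> r) * Mval d (\<sigma> r) = spinS d * (spinS d + 1)"
    by (simp add: Mval_def spinS_def field_simps)
  finally have PQ: "(?P (?Q v) \<sigma> + ?Q (?P v) \<sigma>) / 2 + of_real (Mval d (\<sigma> r) * Mval d (\<sigma> r)) * v \<sigma>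
    = of_real (spinS d * (spinS d + 1)) * v \<sigma>" .
  have "(pp + pq + qp + qq) / 4 + - (pp - pq - qp + qq) / 4 + z = (pq + qp) / 2 + z"
    for pp pq qp qq z :: complex
    by (simp add: field_simps)
  then show ?thesis unfolding X Y Z PQ[symmetric] .
qed

text \<open>This and the next commutator express each of Z and X through Y and the other one; in
  eigenvectors of one coupled component they make the expectation of the other vanish.\<close>

lemma commutator_XY:
  assumes r: "r \<in> torus N" and v: "v \<in> vecs (confs N d)"
  shows "mv (confs N d) (spin d CX r) (mv (confs N d) (spin d CY r) v) \<sigma>
    - mv (confs N d) (spin d CY r) (mv (confs N d) (spin d CX r) v) \<sigma>
    = \<i> * mv (confs N d) (spin d CZ r) v \<sigma>"
proof -
  let ?P = "mv (confs N d) (Splus d r)" and ?Q = "mv (confs N d) (Sminus d r)"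
  have "mv (confs N d) (spin d CX r) (mv (confs N d) (spin d CY r) v) \<sigma>
    - mv (confs N d) (spin d CY r) (mv (confs N d) (spin d CX r) v) \<sigma>
    = (?P (?Q v) \<sigma> - ?Q (?P v) \<sigma>) * (\<i> / 2)"
    by (simp only: mv_Sx mv_Sy mv_add mv_diff mv_divide mv_scale) (simp add: field_simps)
  also have "?P (?Q v) \<sigma> - ?Q (?P v) \<sigma> = of_real (2 * Mval d (\<sigma> r)) * v \<sigma>"
    unfolding Splus_Sminus[OF r v] Sminus_Splus[OF r v] Mval_def
    by (simp add: algebra_simps)
  finally show ?thesis by (simp add: mv_Sz[OF v])
qed

lemma commutator_ZY:
  assumes r: "r \<in> torus N" and v: "v \<in> vecs (confs N d)"
  shows "mv (confs N d) (spin d CZ r) (mv (confs N d) (spin d CY r) v) \<sigma>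
    - mv (confs N d) (spin d CY r) (mv (confs N d) (spin d CZ r) v) \<sigma>
    = - \<i> * mv (confs N d) (spin d CX r) v \<sigma>"
proof -
  let ?P = "mv (confs N d) (Splus d r)" and ?Q = "mv (confs N d) (Sminus d r)"
    and ?Z = "mv (confs N d) (spin d CZ r)"
  have P: "?P (?Z v) \<sigma> = (of_real (Mval d (\<sigma> r)) - 1) * ?P v \<sigma>"
    unfolding mv_Splus[OF r mv_vecs] mv_Splus[OF r v] unfolding mv_Sz[OF v]
    by (cases "\<sigma> r") (simp_all add: Mval_def)
  have Q: "?Q (?Z v) \<sigma> = (of_real (Mval d (\<sigma> r)) + 1) * ?Q v \<sigma>"
    unfolding mv_Sminus[OF r mv_vecs] mv_Sminus[OF r v] unfolding mv_Sz[OF v]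
    by (simp add: Mval_def)
  show ?thesis
    unfolding mv_Sz[OF mv_vecs] unfolding mv_Sy mv_Sx P Q
    by (simp add: field_simps)
qed

lemma spin_herm:
  assumes r: "r \<in> torus N"
  shows "herm (confs N d) (spin d a r)"
proof -
  have PQ: "Splus d r \<sigma> \<tau> = cnj (Sminus d r \<tau> \<sigma>)"
    if "\<sigma> \<in> confs N d" "\<tau> \<in> confs N d" for \<sigma> \<tau>
  proof -
    have iff: "(\<tau> r < d \<and> \<sigma> = \<tau>(r := Suc (\<tau> r))) \<longleftrightarrow> (0 < \<sigma> r \<and> \<tau> = \<sigma>(r := \<sigma> r - 1))"
      using confs_le[OF that(1) r] by (auto simp: fun_eq_iff)
    show ?thesis
    proof (cases "\<tau> r < d \<and> \<sigma> = \<tau>(r := Suc (\<tau> r))")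
      case True
      then have "Mval d (\<sigma> r) = Mval d (\<tau> r) + 1" by (simp add: Mval_def)
      then show ?thesis
        using True iff by (simp add: Splus_def Sminus_def algebra_simps)
    next
      case False
      then have "\<not> (0 < \<sigma> r \<and> \<tau> = \<sigma>(r := \<sigma> r - 1))" using iff by blast
      then show ?thesis using False by (simp only: Splus_def Sminus_def if_False complex_cnj_zero)
    qed
  qed
  have QP: "Sminus d r \<sigma> \<tau> = cnj (Splus d r \<tau> \<sigma>)"
    if "\<sigma> \<in> confs N d" "\<tau> \<in> confs N d" for \<sigma> \<tau>
    using PQ[OF that(2,1)] by simp
  show ?thesis
    unfolding herm_def
  proof (intro ballI)
    fix \<sigma> \<tau> assume m: "\<sigma> \<in> confs N d" "\<tau> \<in> confs N d"
    show "spin d a r \<sigma> \<tau> = cnj (spin d a r \<tau> \<sigma>)"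
    proof (cases a)
      case CX
      then show ?thesis
        using PQ[OF m] QP[OF m] by (simp add: spin_def Sx_def add.commute)
    next
      case CY
      then show ?thesis
        using PQ[OF m] QP[OF m] by (simp add: spin_def Sy_def field_simps)
    next
      case CZ
      then show ?thesis by (simp add: spin_def Sz_def)
    qed
  qed
qed

section \<open>Quartic moments and eigenvectors of the spin operators\<close>

lemma casimir_nsq:
  assumes r: "r \<in> torus N" and v: "v \<in> vecs (confs N d)"
  shows "nsq (confs N d) (mv (confs N d) (spin d CX r) v)
    + nsq (confs N d) (mv (confs N d) (spin d CY r) v)
    + nsq (confs N d) (mv (confs N d) (spin d CZ r) v) = spinS d * (spinS d + 1) * nsq (confs N d) v"
proof -
  let ?C = "confs N d" and ?T = "\<lambda>a. mv (confs N d) (spin d a r)"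
  have n: "ip ?C v (?T a (?T a v)) = of_real (nsq ?C (?T a v))" for a
    by (simp add: ip_mv_herm[OF spin_herm[OF r]] ip_self)
  have "ip ?C v (\<lambda>\<sigma>. ?T CX (?T CX v) \<sigma> + ?T CY (?T CY v) \<sigma> + ?T CZ (?T CZ v) \<sigma>)
      = of_real (spinS d * (spinS d + 1) * nsq ?C v)"
    unfolding casimir[OF r v] ip_scale_right ip_self by simp
  then have "complex_of_real (nsq ?C (?T CX v) + nsq ?C (?T CY v) + nsq ?C (?T CZ v))
      = of_real (spinS d * (spinS d + 1) * nsq ?C v)"
    by (simp add: ip_add_right n)
  then show ?thesis by (simp only: of_real_eq_iff)
qed

text \<open>Drop two of the three nonnegative terms of the Casimir identity. This gives S(S+1) in
  place of the sharp S^2, a loss of a factor 1 + 1/S.\<close>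

lemma nsq_spin_le:
  assumes r: "r \<in> torus N" and v: "v \<in> vecs (confs N d)"
  shows "nsq (confs N d) (mv (confs N d) (spin d a r) v) \<le> spinS d * (spinS d + 1) * nsq (confs N d) v"
proof (cases a)
qed (use casimir_nsq[OF r v] nsq_nonneg[of "confs N d" "mv (confs N d) (spin d CX r) v"]
    nsq_nonneg[of "confs N d" "mv (confs N d) (spin d CY r) v"]
    nsq_nonneg[of "confs N d" "mv (confs N d) (spin d CZ r) v"] in simp_all)

text \<open>Commutation moves one \<open>A\<close> and one \<open>B\<close> to the left vector, so
  the quartic expectation becomes a squared norm and is manifestly nonnegative.\<close>

lemma ip_spin_quartic:
  assumes r: "r \<in> torus N" "r' \<in> torus N" and v: "v \<in> vecs (confs N d)"
  shows "ip (confs N d) v (mv (confs N d)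
      (opmul N d (opmul N d (opmul N d (spin d a r) (spin d a r)) (spin d a r')) (spin d a r')) v)
    = of_real (nsq (confs N d) (mv (confs N d) (spin d a r') (mv (confs N d) (spin d a r) v)))"
proof -
  let ?A = "mv (confs N d) (spin d a r)" and ?B = "mv (confs N d) (spin d a r')"
  have com: "?A (?B u) = ?B (?A u)" if "u \<in> vecs (confs N d)" for u
    using spin_commute[OF r _ that] by (cases "r = r'") auto
  have "ip (confs N d) v (?A (?A (?B (?B v)))) = ip (confs N d) (?A v) (?B (?B (?A v)))"
    unfolding ip_mv_herm[OF spin_herm[OF r(1)], where u = v] by (simp only: com[OF mv_vecs] com[OF v])
  then show ?thesis
    by (simp add: mv_opmul ip_mv_herm[OF spin_herm[OF r(2)]] ip_self)
qed

text \<open>This is the positivity of (s - A^2)(s - B^2) with s = S(S+1). At equal sites the product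
  is a square. At distinct sites no square root of s - B^2 is taken: by Casimir at \<open>r'\<close>
  it is the sum of the squares of the two other components, each of which commutes with
  \<open>A\<close> and is estimated by \<open>nsq_spin_le\<close>.\<close>

lemma quartic_ge:
  assumes r: "r \<in> torus N" "r' \<in> torus N" and v: "v \<in> vecs (confs N d)"
  shows "nsq (confs N d) (mv (confs N d) (spin d a r') (mv (confs N d) (spin d a r) v))
    \<ge> spinS d * (spinS d + 1) * (nsq (confs N d) (mv (confs N d) (spin d a r) v)
        + nsq (confs N d) (mv (confs N d) (spin d a r') v))
      - (spinS d * (spinS d + 1))\<^sup>2 * nsq (confs N d) v"
proof -
  let ?C = "confs N d" and ?A = "\<lambda>a. mv (confs N d) (spin d a r)" and ?B = "\<lambda>a. mv (confs N d) (spin d a r')"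
  define s where "s = spinS d * (spinS d + 1)"
  show ?thesis
  proof (cases "r = r'")
    case True
    let ?u = "\<lambda>\<sigma>. of_real s * v \<sigma> - ?A a (?A a v) \<sigma>"
    have "ip ?C v (?A a (?A a v)) = of_real (nsq ?C (?A a v))"
      by (simp add: ip_mv_herm[OF spin_herm[OF r(1)]] ip_self)
    then have "nsq ?C ?u = s\<^sup>2 * nsq ?C v - 2 * s * nsq ?C (?A a v) + nsq ?C (?A a (?A a v))"
      by (simp add: nsq_diff nsq_scale ip_scale_left)
    then show ?thesis
      using nsq_nonneg[of ?C ?u] True by (simp add: s_def[symmetric])
  next
    case False
    have com: "?B b (?A a v) = ?A a (?B b v)" for b
      using spin_commute[OF r False v] by simp
    have le: "nsq ?C (?B b (?A a v)) \<le> s * nsq ?C (?B b v)" for b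
      unfolding com s_def by (rule nsq_spin_le[OF r(1) mv_vecs])
    have 1: "nsq ?C (?B CX (?A a v)) + nsq ?C (?B CY (?A a v)) + nsq ?C (?B CZ (?A a v)) = s * nsq ?C (?A a v)"
      unfolding s_def by (rule casimir_nsq[OF r(2) mv_vecs])
    have "s * (nsq ?C (?B CX v) + nsq ?C (?B CY v) + nsq ?C (?B CZ v)) = s * (s * nsq ?C v)"
      using casimir_nsq[OF r(2) v] by (simp add: s_def)
    then have 2: "s * nsq ?C (?B CX v) + s * nsq ?C (?B CY v) + s * nsq ?C (?B CZ v) = s\<^sup>2 * nsq ?C v"
      by (simp add: power2_eq_square algebra_simps)
    show ?thesis
      unfolding s_def[symmetric] unfolding distrib_left
      using le[of CX] le[of CY] le[of CZ] 1 2 by (cases a) simp_all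
  qed
qed

text \<open>Up to normalisation, the coefficients of \<open>(1 + t)^m (1 - t)^(d - m)\<close> form an eigenvector of
  \<open>S\<^sup>x\<close>: in the polynomial representation \<open>2 S\<^sup>x\<close> is the operator
  \<open>(1 - t\<^sup>2) d/dt + d t\<close>.\<close>

definition kraw_poly :: "nat \<Rightarrow> nat \<Rightarrow> real poly" where
  "kraw_poly m n = [:1, 1:] ^ m * [:1, -1:] ^ n"

text \<open>With m + n = d this is the eigenvalue equation of the operator above, with eigenvalue m
  - n = 2m - d. Comparing coefficients gives the three-term recurrence.\<close>

lemma pderiv_kraw_poly:
  "pderiv (kraw_poly m n) * [:1, 0, -1:] = [:real m - real n, - (real m + real n):] * kraw_poly m n"
proof -
  have 1: "pderiv ([:1, 1:] ^ m) * [:1, 1:] = smult (real m) ([:1, 1 :: real:] ^ m)"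
  proof (cases m)
    case (Suc k)
    show ?thesis unfolding Suc pderiv_power_Suc by (simp add: pderiv_pCons smult_add_right smult_diff_right smult_add_left smult_diff_left)
  qed simp
  have 2: "pderiv ([:1, -1:] ^ n) * [:1, -1:] = smult (- real n) ([:1, -1 :: real:] ^ n)"
  proof (cases n)
    case (Suc k)
    show ?thesis unfolding Suc pderiv_power_Suc by (simp add: pderiv_pCons smult_add_right smult_diff_right smult_add_left smult_diff_left)
  qed simp
  have 3: "[:1, 0, -1 :: real:] = [:1, 1:] * [:1, -1:]" by simp
  have 4: "(p * q' + q * p') * (u * w) = p * u * (q' * w) + q * w * (p' * u)"
    for p q p' q' u w :: "real poly"
    by (simp add: algebra_simps)
  have 5: "p * u * smult y q + q * w * smult x p = (smult x w + smult y u) * (p * q)"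
    for p q u w :: "real poly" and x y
    by (simp add: algebra_simps smult_add_right)
  have "pderiv (kraw_poly m n) * [:1, 0, -1:]
      = (smult (real m) [:1, -1:] + smult (- real n) [:1, 1:]) * kraw_poly m n"
    unfolding kraw_poly_def 3 pderiv_mult 4 1 2 5 ..
  then show ?thesis by simp
qed

text \<open>The value at d - m of the binary Krawtchouk polynomial of degree s.\<close>

definition kraw :: "nat \<Rightarrow> nat \<Rightarrow> nat \<Rightarrow> real" where
  "kraw d m s = coeff (kraw_poly m (d - m)) s"

lemma kraw_rec_0: "m \<le> d \<Longrightarrow> kraw d m 1 = (2 * real m - real d) * kraw d m 0"
  using arg_cong[OF pderiv_kraw_poly[of m "d - m"], of "\<lambda>p. coeff p 0"]
  by (simp add: kraw_def coeff_mult coeff_pderiv of_nat_diff)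

lemma kraw_rec_Suc:
  assumes "m \<le> d"
  shows "(real s + 2) * kraw d m (s + 2) + (real d - real s) * kraw d m s
    = (2 * real m - real d) * kraw d m (Suc s)"
proof -
  have "coeff (pderiv (kraw_poly m (d - m)) * [:1, 0, -1:]) (Suc s)
      = (real s + 2) * kraw d m (s + 2) - real s * kraw d m s"
    by (cases s) (simp_all add: kraw_def coeff_pderiv)
  moreover have "coeff ([:real m - real (d - m), - (real m + real (d - m)):] * kraw_poly m (d - m)) (Suc s)
      = (2 * real m - real d) * kraw d m (Suc s) - real d * kraw d m s"
    using assms by (simp add: kraw_def of_nat_diff algebra_simps)
  ultimately show ?thesis
    unfolding pderiv_kraw_poly by (simp add: algebra_simps)
qed

lemma kraw_beyond: "m \<le> d \<Longrightarrow> kraw d m (Suc d) = 0"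
proof -
  assume "m \<le> d"
  have "degree (kraw_poly m (d - m)) \<le> degree ([:1, 1 :: real:] ^ m) + degree ([:1, -1 :: real:] ^ (d - m))"
    unfolding kraw_poly_def by (rule degree_mult_le)
  also have "\<dots> \<le> m + (d - m)"
    using degree_power_le[of "[:1, 1 :: real:]" m] degree_power_le[of "[:1, -1 :: real:]" "d - m"]
    by (intro add_mono) simp_all
  finally show ?thesis
    using \<open>m \<le> d\<close> by (simp add: kraw_def coeff_eq_0)
qed

lemma kraw_0: "kraw d m 0 = 1"
  by (simp add: kraw_def kraw_poly_def coeff_0_power flip: poly_0_coeff_0)

text \<open>Monomials are orthogonal but not normalised in the polynomial representation. Dividing
  by the square root of the binomial coefficient passes to the orthonormal basis and makes the
  recurrence symmetric, with \<open>ladder\<close> as its off-diagonal entries.\<close>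

definition krawn :: "nat \<Rightarrow> nat \<Rightarrow> nat \<Rightarrow> real" where
  "krawn d m s = kraw d m s / sqrt (d choose s)"

lemma ladder_Suc_binomial:
  assumes "t < d"
  shows "ladder d (Suc t) / sqrt (d choose t) = (real d - real t) / sqrt (d choose Suc t)"
    "ladder d (Suc t) / sqrt (d choose Suc t) = (real t + 1) / sqrt (d choose t)"
proof -
  define x where "x = real (d choose t)"
  define y where "y = real (d choose Suc t)"
  have pos: "x > 0" "y > 0" using assms by (simp_all add: x_def y_def zero_less_binomial)
  have "Suc t * (d choose Suc t) = (d - t) * (d choose t)"
    by (metis binomial_absorb_comp binomial_absorption)
  from arg_cong[OF this, of real] have xy: "(real t + 1) * y = (real d - real t) * x"
    using assms by (simp add: x_def y_def of_nat_diff algebra_simps)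
  have L: "ladder d (Suc t) = sqrt ((real t + 1) * (real d - real t))"
    by (simp add: ladder_def add.commute)
  have dt: "real d - real t \<ge> 0" using assms by simp
  have "ladder d (Suc t) * sqrt y = sqrt ((real d - real t)\<^sup>2 * x)"
    unfolding L real_sqrt_mult[symmetric] using xy
    by (simp add: power2_eq_square mult.assoc mult.left_commute)
  also have "\<dots> = (real d - real t) * sqrt x" using dt by (simp add: real_sqrt_mult)
  finally have 1: "ladder d (Suc t) * sqrt y = (real d - real t) * sqrt x" .
  have "ladder d (Suc t) * sqrt x = sqrt ((real t + 1)\<^sup>2 * y)"
    unfolding L real_sqrt_mult[symmetric] using xy
    by (simp add: power2_eq_square mult.assoc mult.left_commute)
  also have "\<dots> = (real t + 1) * sqrt y" by (simp add: real_sqrt_mult)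
  finally have 2: "ladder d (Suc t) * sqrt x = (real t + 1) * sqrt y" .
  show "ladder d (Suc t) / sqrt (d choose t) = (real d - real t) / sqrt (d choose Suc t)"
    using 1 pos by (simp add: x_def[symmetric] y_def[symmetric] frac_eq_eq)
  show "ladder d (Suc t) / sqrt (d choose Suc t) = (real t + 1) / sqrt (d choose t)"
    using 2 pos by (simp add: x_def[symmetric] y_def[symmetric] frac_eq_eq)
qed

text \<open>The one-site eigenvalue equation for 2 S^x. At s = 0 the index s - 1 is truncated, but
  its coefficient is 0; at s = d the polynomial has no coefficient beyond its degree.\<close>

lemma krawn_rec:
  assumes m: "m \<le> d" and s: "s \<le> d"
  shows "ladder d s * krawn d m (s - 1) + ladder d (Suc s) * krawn d m (Suc s)
    = 2 * Mval d m * krawn d m s"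
proof -
  define B where "B = sqrt (d choose s)"
  have up: "ladder d (Suc s) * krawn d m (Suc s) = (real s + 1) * kraw d m (Suc s) / B"
  proof (cases "s = d")
    case True
    then show ?thesis using kraw_beyond[OF m] by simp
  next
    case False
    then have "ladder d (Suc s) / sqrt (d choose Suc s) = (real s + 1) / sqrt (d choose s)"
      using s by (intro ladder_Suc_binomial) simp
    then show ?thesis by (simp add: krawn_def B_def mult.commute) (metis times_divide_eq_right mult.commute)
  qed
  show ?thesis
  proof (cases s)
    case 0
    then show ?thesis
      using up kraw_rec_0[OF m] by (simp add: krawn_def Mval_def B_def)
  next
    case (Suc t)
    have "ladder d (Suc t) / sqrt (d choose t) = (real d - real t) / sqrt (d choose Suc t)"
      using Suc s by (intro ladder_Suc_binomial) simp
    then have "ladder d s * krawn d m (s - 1) = (real d - real t) * kraw d m t / B"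
      using Suc by (simp add: krawn_def B_def) (metis times_divide_eq_right mult.commute)
    then have "ladder d s * krawn d m (s - 1) + ladder d (Suc s) * krawn d m (Suc s)
       = ((real t + 2) * kraw d m (t + 2) + (real d - real t) * kraw d m t) / B"
      using up Suc by (simp add: add_divide_distrib add.commute)
    also have "\<dots> = 2 * Mval d m * krawn d m s"
      unfolding kraw_rec_Suc[OF m] using Suc by (simp add: krawn_def Mval_def B_def)
    finally show ?thesis .
  qed
qed

section \<open>Joint eigenvectors of one spin component\<close>

definition xvec :: "nat \<Rightarrow> nat \<Rightarrow> conf \<Rightarrow> conf \<Rightarrow> complex" where
  "xvec N d m \<sigma> = (if \<sigma> \<in> confs N d then of_real (\<Prod>r\<in>torus N. krawn d (m r) (\<sigma> r)) else 0)"

lemma xvec_vecs: "xvec N d m \<in> vecs (confs N d)"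
  by (simp add: xvec_def vecs_def)

text \<open>At the all-zero configuration every factor is the constant coefficient of its
  polynomial, namely 1.\<close>

lemma xvec_nonzero: "xvec N d m \<noteq> (\<lambda>_. 0)"
proof
  assume "xvec N d m = (\<lambda>_. 0)"
  then have "xvec N d m (\<lambda>_. 0) = 0" by simp
  then show False by (simp add: xvec_def confs_def krawn_def kraw_0)
qed

lemma xvec_eigen:
  assumes m: "m \<in> confs N d" and r: "r \<in> torus N"
  shows "mv (confs N d) (spin d CX r) (xvec N d m) = (\<lambda>\<sigma>. of_real (Mval d (m r)) * xvec N d m \<sigma>)"
proof
  fix \<sigma>
  show "mv (confs N d) (spin d CX r) (xvec N d m) \<sigma> = of_real (Mval d (m r)) * xvec N d m \<sigma>"
  proof (cases "\<sigma> \<in> confs N d")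
    case True
    define R where "R = (\<Prod>r'\<in>torus N - {r}. krawn d (m r') (\<sigma> r'))"
    have upd: "xvec N d m (\<sigma>(r := s)) = of_real (krawn d (m r) s * R)" if "s \<le> d" for s
    proof -
      have "(\<Prod>r'\<in>torus N. krawn d (m r') ((\<sigma>(r := s)) r'))
          = krawn d (m r) s * (\<Prod>r'\<in>torus N - {r}. krawn d (m r') ((\<sigma>(r := s)) r'))"
        using r by (simp add: prod.remove[OF torus_finite])
      also have "(\<Prod>r'\<in>torus N - {r}. krawn d (m r') ((\<sigma>(r := s)) r')) = R"
        unfolding R_def by (intro prod.cong) auto
      finally show ?thesis
        using confs_upd[OF True r that] by (simp only: xvec_def if_True)
    qed
    have le: "\<sigma> r \<le> d" "m r \<le> d" using confs_le[OF True r] confs_le[OF m r] by auto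
    \<comment> \<open>At the top value the raised configuration leaves \<open>confs\<close>, where
      \<open>upd\<close> says nothing, but the coefficient is then 0.\<close>
    have hi: "of_real (ladder d (Suc (\<sigma> r))) * xvec N d m (\<sigma>(r := Suc (\<sigma> r)))
        = of_real (ladder d (Suc (\<sigma> r)) * krawn d (m r) (Suc (\<sigma> r)) * R)"
      using upd[of "Suc (\<sigma> r)"] le by (cases "\<sigma> r = d") simp_all
    have lo: "of_real (ladder d (\<sigma> r)) * xvec N d m (\<sigma>(r := \<sigma> r - 1))
        = of_real (ladder d (\<sigma> r) * krawn d (m r) (\<sigma> r - 1) * R)"
      using upd[of "\<sigma> r - 1"] le by simp
    have "mv (confs N d) (spin d CX r) (xvec N d m) \<sigma>
        = of_real ((ladder d (\<sigma> r) * krawn d (m r) (\<sigma> r - 1)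
            + ladder d (Suc (\<sigma> r)) * krawn d (m r) (Suc (\<sigma> r))) * R / 2)"
      unfolding mv_Sx mv_Splus[OF r xvec_vecs] mv_Sminus[OF r xvec_vecs] lo hi
      by (simp add: distrib_right)
    also have "\<dots> = of_real (Mval d (m r)) * of_real (krawn d (m r) (\<sigma> r) * R)"
      unfolding krawn_rec[OF le(2,1)] by simp
    also have "of_real (krawn d (m r) (\<sigma> r) * R) = xvec N d m \<sigma>"
      using upd[OF le(1)] by (simp only: fun_upd_triv)
    finally show ?thesis .
  qed (simp add: mv_def xvec_def)
qed

text \<open>Orthogonality is automatic: two labels differ at some site, which lies on the torus
  because configurations vanish elsewhere, and there a Hermitian operator has different eigenvalues
  on the two vectors. Only normalisation remains.\<close>

lemma joint_eigenvectors_orthonormal: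
  assumes g: "\<And>m. m \<in> confs N d \<Longrightarrow> g m \<in> vecs (confs N d)" "\<And>m. m \<in> confs N d \<Longrightarrow> g m \<noteq> (\<lambda>_. 0)"
    and e: "\<And>m r. m \<in> confs N d \<Longrightarrow> r \<in> torus N \<Longrightarrow>
      mv (confs N d) (spin d a r) (g m) = (\<lambda>\<sigma>. of_real (Mval d (m r)) * g m \<sigma>)"
  obtains f where "orthonormal (confs N d) (confs N d) f"
    "\<And>m r. m \<in> confs N d \<Longrightarrow> r \<in> torus N \<Longrightarrow>
      mv (confs N d) (spin d a r) (f m) = (\<lambda>\<sigma>. of_real (Mval d (m r)) * f m \<sigma>)"
proof -
  let ?C = "confs N d"
  have "\<forall>m\<in>?C. \<exists>c. nsq ?C (\<lambda>x. c * g m x) = 1 \<and> (\<lambda>x. c * g m x) \<in> vecs ?C"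
    using normalize_vec[OF confs_finite g(1) g(2)] by metis
  then obtain c where c: "\<And>m. m \<in> ?C \<Longrightarrow> nsq ?C (\<lambda>x. c m * g m x) = 1"
    "\<And>m. m \<in> ?C \<Longrightarrow> (\<lambda>x. c m * g m x) \<in> vecs ?C"
    by metis
  define f where "f m = (\<lambda>x. c m * g m x)" for m
  have fe: "mv ?C (spin d a r) (f m) = (\<lambda>\<sigma>. of_real (Mval d (m r)) * f m \<sigma>)"
    if "m \<in> ?C" "r \<in> torus N" for m r
    unfolding f_def mv_scale e[OF that] by (simp add: mult_ac)
  have orth: "ip ?C (f m) (f m') = 0" if mm: "m \<in> ?C" "m' \<in> ?C" "m \<noteq> m'" for m m'
  proof -
    obtain r where r: "m r \<noteq> m' r" using mm(3) by blast
    then have rt: "r \<in> torus N" using mm(1,2) by (force simp: confs_def)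
    have "of_real (Mval d (m' r)) * ip ?C (f m) (f m') = ip ?C (f m) (mv ?C (spin d a r) (f m'))"
      by (simp add: fe[OF mm(2) rt] ip_scale_right)
    also have "\<dots> = of_real (Mval d (m r)) * ip ?C (f m) (f m')"
      by (simp add: ip_mv_herm[OF spin_herm[OF rt]] fe[OF mm(1) rt] ip_scale_left)
    finally show ?thesis using r by (simp add: Mval_def)
  qed
  have "orthonormal ?C ?C f"
    using orth c unfolding orthonormal_def by (auto simp: ip_self f_def)
  then show ?thesis using fe that by blast
qed

lemma trial_family:
  assumes "a = CX \<or> a = CZ"
  obtains f where "orthonormal (confs N d) (confs N d) f"
    "\<And>m r. m \<in> confs N d \<Longrightarrow> r \<in> torus N \<Longrightarrow>
      mv (confs N d) (spin d a r) (f m) = (\<lambda>\<sigma>. of_real (Mval d (m r)) * f m \<sigma>)"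
  using assms
proof
  assume "a = CX"
  then show ?thesis
    using joint_eigenvectors_orthonormal[of N d "xvec N d" CX] xvec_vecs xvec_nonzero xvec_eigen that
    by blast
next
  assume a: "a = CZ"
  have ne: "unitvec m \<noteq> (\<lambda>_. 0)" for m :: conf
    by (metis unitvec_def zero_neq_one)
  have eig: "mv (confs N d) (spin d CZ r) (unitvec m) = (\<lambda>\<sigma>. of_real (Mval d (m r)) * unitvec m \<sigma>)"
    if "m \<in> confs N d" for m r
    unfolding mv_Sz[OF unitvec_vecs[OF that]] by (auto simp: unitvec_def)
  show ?thesis
    by (rule joint_eigenvectors_orthonormal[OF unitvec_vecs ne eig]) (use that a in auto)
qed

text \<open>The operator \<open>b\<close> at \<open>r'\<close> commutes with \<open>a\<close> at
  \<open>r\<close>, so \<open>v\<close> and its image \<open>u\<close> are eigenvectors of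
  \<open>a\<close> at \<open>r\<close> with the same eigenvalue. Between such vectors the commutator
  of \<open>a\<close> and \<open>CY\<close> at \<open>r\<close> has matrix element 0, and it is a
  nonzero multiple of \<open>b\<close>.\<close>

lemma transverse_correlation_zero:
  assumes r: "r \<in> torus N" "r' \<in> torus N" "r \<noteq> r'" and v: "v \<in> vecs (confs N d)"
    and ab: "(a, b) = (CX, CZ) \<or> (a, b) = (CZ, CX)"
    and e: "mv (confs N d) (spin d a r) v = (\<lambda>\<sigma>. complex_of_real \<mu> * v \<sigma>)"
  shows "ip (confs N d) v (mv (confs N d) (spin d b r) (mv (confs N d) (spin d b r') v)) = 0"
proof -
  let ?C = "confs N d" and ?T = "\<lambda>a. mv (confs N d) (spin d a r)"
  define u where "u = mv ?C (spin d b r') v"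
  have uv: "u \<in> vecs ?C" by (simp add: u_def mv_vecs)
  have au: "?T a u = (\<lambda>\<sigma>. of_real \<mu> * u \<sigma>)"
    unfolding u_def spin_commute[OF r v] e by (rule mv_scale)
  have "ip ?C v (\<lambda>\<sigma>. ?T a (?T CY u) \<sigma> - ?T CY (?T a u) \<sigma>) = 0"
    unfolding ip_diff_right ip_mv_herm[OF spin_herm[OF r(1)], where u = v and v = "?T CY u"] au mv_scale e
    by (simp add: ip_scale_left ip_scale_right)
  moreover obtain c where "c \<noteq> 0" "\<And>\<sigma>. ?T a (?T CY u) \<sigma> - ?T CY (?T a u) \<sigma> = c * ?T b u \<sigma>"
  proof (cases "a = CX")
    case True
    then show ?thesis using that[of \<i>] commutator_XY[OF r(1) uv] ab by auto
  next
    case False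
    then show ?thesis using that[of "- \<i>"] commutator_ZY[OF r(1) uv] ab by auto
  qed
  ultimately show ?thesis by (simp add: ip_scale_right u_def)
qed

section \<open>Energy bounds\<close>

text \<open>Extended by the identity off the torus, so that it is a bijection of all sites and acts
  on configurations by composition.\<close>

definition shift :: "nat \<Rightarrow> nat \<Rightarrow> nat \<Rightarrow> site \<Rightarrow> site" where
  "shift N i j r = (if r \<in> torus N then ((fst r + i) mod N, (snd r + j) mod N) else r)"

lemma shift_torus: "shift N i j r \<in> torus N \<longleftrightarrow> r \<in> torus N"
  by (auto simp: shift_def torus_def)

lemma shift_inverse:
  assumes "i \<le> N" "j \<le> N"
  shows "shift N (N - i) (N - j) (shift N i j r) = r" "shift N i j (shift N (N - i) (N - j) r) = r"
proof -
  have 1: "((k + i) mod N + (N - i)) mod N = k" "((k + (N - i)) mod N + i) mod N = k"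
    if "k < N" "i \<le> N" for k i
    unfolding mod_add_left_eq using that by (simp_all add: add.assoc)
  show "shift N (N - i) (N - j) (shift N i j r) = r" "shift N i j (shift N (N - i) (N - j) r) = r"
    using assms shift_torus[of N i j r] shift_torus[of N "N - i" "N - j" r]
    by (auto simp: shift_def torus_def 1 simp del: Nat.add_diff_assoc)
qed

lemma bij_betw_shift:
  assumes "i \<le> N" "j \<le> N"
  shows "bij_betw (shift N i j) (torus N) (torus N)"
  by (rule bij_betw_byWitness[where f' = "shift N (N - i) (N - j)"])
     (auto simp: shift_inverse[OF assms] shift_torus)

lemma bij_shift:
  assumes "i \<le> N" "j \<le> N"
  shows "bij (shift N i j)"
  by (rule o_bij[of "shift N (N - i) (N - j)"]) (auto simp: shift_inverse[OF assms])

lemma nb1_shift: "r \<in> torus N \<Longrightarrow> nb1 N r = shift N 1 0 r"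
  by (auto simp: nb1_def shift_def torus_def)

lemma nb2_shift: "r \<in> torus N \<Longrightarrow> nb2 N r = shift N 0 1 r"
  by (auto simp: nb2_def shift_def torus_def)

lemma nb_torus: "r \<in> torus N \<Longrightarrow> nb1 N r \<in> torus N" "r \<in> torus N \<Longrightarrow> nb2 N r \<in> torus N"
  by (simp_all add: nb1_shift nb2_shift shift_torus)

lemma nb_neq:
  assumes "N \<ge> 2" "r \<in> torus N"
  shows "r \<noteq> nb1 N r" "r \<noteq> nb2 N r"
proof -
  have *: "(k + 1) mod N \<noteq> k" if "k < N" for k
    using that assms(1) by (cases "k + 1 = N") auto
  have "fst r < N" "snd r < N" using assms(2) by (auto simp: torus_def)
  then show "r \<noteq> nb1 N r" "r \<noteq> nb2 N r"
    unfolding nb1_def nb2_def prod_eq_iff using *[of "fst r"] *[of "snd r"] by (metis fst_conv snd_conv)+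
qed

text \<open>The sum over edges of one type, each edge listed at its starting site;
  \<open>even\<close> selects x-edges and \<open>odd\<close> z-edges. The values are kept generic
  because matrix entries, inner products and real bounds are all summed this way.\<close>

definition esum :: "nat \<Rightarrow> (nat \<Rightarrow> bool) \<Rightarrow> (site \<Rightarrow> site \<Rightarrow> 'b::comm_monoid_add) \<Rightarrow> 'b" where
  "esum N P g = (\<Sum>r\<in>torus N. (if P (fst r) then g r (nb1 N r) else 0)
     + (if P (snd r) then g r (nb2 N r) else 0))"

lemma esum_cong:
  assumes "\<And>r r'. r \<in> torus N \<Longrightarrow> r' = nb1 N r \<or> r' = nb2 N r \<Longrightarrow> g r r' = h r r'"
  shows "esum N P g = esum N P h"
  unfolding esum_def using assms by (intro sum.cong refl arg_cong2[where f = "(+)"]) auto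

lemma esum_hom:
  assumes "h 0 = 0" "\<And>x y. h (x + y) = h x + h y"
  shows "h (esum N P g) = esum N P (\<lambda>r r'. h (g r r'))"
  unfolding esum_def sum_comp_morphism[of h, OF assms, symmetric]
  using assms by (intro sum.cong refl) simp

lemma esum_mono:
  fixes g :: "site \<Rightarrow> site \<Rightarrow> real"
  assumes "\<And>r r'. r \<in> torus N \<Longrightarrow> r' = nb1 N r \<or> r' = nb2 N r \<Longrightarrow> g r r' \<le> h r r'"
  shows "esum N P g \<le> esum N P h"
  unfolding esum_def using assms by (intro sum_mono add_mono) auto

text \<open>In each direction edge types alternate around the cycle, so a site either starts a
  \<open>P\<close>-edge or ends one, never both. Two directions give the factor 2. The alternation
  across the wrap-around comes from N being even.\<close>

lemma esum_endpoints:
  fixes g :: "site \<Rightarrow> real"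
  assumes N: "N \<ge> 2" and P: "\<And>k. k < N \<Longrightarrow> P ((k + 1) mod N) \<longleftrightarrow> \<not> P k"
  shows "esum N P (\<lambda>r r'. g r + g r') = 2 * (\<Sum>r\<in>torus N. g r)"
proof -
  have *: "(\<Sum>r\<in>torus N. if P (p r) then g r + g (nb r) else 0) = (\<Sum>r\<in>torus N. g r)"
    if p: "\<And>r. r \<in> torus N \<Longrightarrow> P (p (nb r)) \<longleftrightarrow> \<not> P (p r)"
      and nb: "bij_betw nb (torus N) (torus N)" for p :: "site \<Rightarrow> nat" and nb
  proof -
    have "(\<Sum>r\<in>torus N. if P (p r) then g r + g (nb r) else 0)
      = (\<Sum>r\<in>torus N. if P (p r) then g r else 0) + (\<Sum>r\<in>torus N. if \<not> P (p (nb r)) then g (nb r) else 0)"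
      unfolding sum.distrib[symmetric] using p by (intro sum.cong refl) auto
    also have "(\<Sum>r\<in>torus N. if \<not> P (p (nb r)) then g (nb r) else 0)
        = (\<Sum>r\<in>torus N. if \<not> P (p r) then g r else 0)"
      by (rule sum.reindex_bij_betw[OF nb])
    also have "(\<Sum>r\<in>torus N. if P (p r) then g r else 0) + (\<Sum>r\<in>torus N. if \<not> P (p r) then g r else 0)
        = (\<Sum>r\<in>torus N. g r)"
      unfolding sum.distrib[symmetric] by (intro sum.cong refl) auto
    finally show ?thesis .
  qed
  have "bij_betw (nb1 N) (torus N) (torus N)"
    using bij_betw_shift[of 1 N 0] N by (subst bij_betw_cong[OF nb1_shift]) auto
  moreover have "bij_betw (nb2 N) (torus N) (torus N)"
    using bij_betw_shift[of 0 N 1] N by (subst bij_betw_cong[OF nb2_shift]) auto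
  moreover have "P (fst (nb1 N r)) \<longleftrightarrow> \<not> P (fst r)" "P (snd (nb2 N r)) \<longleftrightarrow> \<not> P (snd r)"
    if "r \<in> torus N" for r
    using that P[of "fst r"] P[of "snd r"] by (auto simp: nb1_def nb2_def torus_def)
  ultimately show ?thesis
    unfolding esum_def sum.distrib using *[of fst "nb1 N"] *[of snd "nb2 N"] by simp
qed

lemma parity_flip:
  fixes k N :: nat
  assumes "even N" "k < N"
  shows "even ((k + 1) mod N) \<longleftrightarrow> \<not> even k" "odd ((k + 1) mod N) \<longleftrightarrow> \<not> odd k"
  unfolding dvd_mod_iff[OF assms(1)] by simp_all

lemma card_torus: "card (torus N) = N * N"
  by (simp add: torus_def)

lemma esum_const:
  assumes N: "N \<ge> 2" and P: "\<And>k. k < N \<Longrightarrow> P ((k + 1) mod N) \<longleftrightarrow> \<not> P k"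
  shows "esum N P (\<lambda>_ _. c :: real) = real N ^ 2 * c"
  using esum_endpoints[where P = P and g = "\<lambda>_. c / 2", OF assms] by (simp add: card_torus power2_eq_square)

section \<open>The quadratic form of the Hamiltonian\<close>

lemma mv_sum_op: "mv C (\<lambda>x y. \<Sum>i\<in>I. A i x y) v = (\<lambda>x. \<Sum>i\<in>I. mv C (A i) v x)"
proof
  fix x
  have "(\<Sum>y\<in>C. \<Sum>i\<in>I. A i x y * v y) = (\<Sum>i\<in>I. \<Sum>y\<in>C. A i x y * v y)"
    by (rule sum.swap)
  then show "mv C (\<lambda>x y. \<Sum>i\<in>I. A i x y) v x = (\<Sum>i\<in>I. mv C (A i) v x)"
    by (simp add: mv_def sum_distrib_right)
qed

lemma mv_add_op: "mv C (\<lambda>x y. A x y + B x y) v = (\<lambda>x. mv C A v x + mv C B v x)"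
  using mv_lincomb[of C 1 A 1 B v] by simp

lemma ip_mv_esum:
  "ip C v (mv C (\<lambda>x y. esum N P (\<lambda>r r'. A r r' x y)) v) = esum N P (\<lambda>r r'. ip C v (mv C (A r r') v))"
proof -
  have if0: "ip C v (mv C (\<lambda>x y. if Q then B x y else 0) v) = (if Q then ip C v (mv C B v) else 0)" for Q B
    by (simp add: mv_def ip_def)
  have "ip C v (\<lambda>x. \<Sum>i\<in>I. h i x) = (\<Sum>i\<in>I. ip C v (h i))" for I :: "site set" and h
    using ip_sum_right[of C v "\<lambda>_. 1" h I] by simp
  then show ?thesis
    unfolding esum_def mv_sum_op mv_add_op by (simp add: ip_add_right if0)
qed

lemma negbH_eq:
  "negbH N d J1 J2 \<beta> = (\<lambda>\<sigma> \<tau>.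
    of_real (\<beta> * J1 / spinS d ^ 2) * esum N even (\<lambda>r r'. opmul N d (spin d CX r) (spin d CX r') \<sigma> \<tau>)
    + of_real (\<beta> * J2 / spinS d ^ 2) * esum N odd (\<lambda>r r'. opmul N d (spin d CZ r) (spin d CZ r') \<sigma> \<tau>))"
proof -
  have "ham N d J1 J2 = (\<lambda>\<sigma> \<tau>.
    - of_real (J1 / spinS d ^ 2) * esum N even (\<lambda>r r'. opmul N d (spin d CX r) (spin d CX r') \<sigma> \<tau>)
    - of_real (J2 / spinS d ^ 2) * esum N odd (\<lambda>r r'. opmul N d (spin d CZ r) (spin d CZ r') \<sigma> \<tau>))"
    unfolding ham_def esum_def spin_def comp.case ..
  then show ?thesis
    unfolding negbH_def by (simp add: right_diff_distrib mult.assoc)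
qed

lemma ip_unitvec_mv:
  assumes "finite C" "x \<in> C" "y \<in> C"
  shows "ip C (unitvec x) (mv C A (unitvec y)) = A x y"
proof -
  have "mv C A (unitvec y) x = A x y"
    using assms by (simp add: mv_def unitvec_def if_distrib cong: if_cong)
  then show ?thesis
    using ip_commute[of C "unitvec x" "mv C A (unitvec y)"] ip_unitvec[OF assms(1,2)] by simp
qed

lemma herm_opmul_spin:
  assumes r: "r \<in> torus N" "r' \<in> torus N" "r \<noteq> r'"
  shows "herm (confs N d) (opmul N d (spin d a r) (spin d a r'))"
  unfolding herm_def
proof (intro ballI)
  fix \<sigma> \<tau> assume m: "\<sigma> \<in> confs N d" "\<tau> \<in> confs N d"
  let ?C = "confs N d" and ?A = "mv (confs N d) (spin d a r)" and ?B = "mv (confs N d) (spin d a r')"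
  have "opmul N d (spin d a r) (spin d a r') \<sigma> \<tau> = ip ?C (unitvec \<sigma>) (?A (?B (unitvec \<tau>)))"
    by (simp add: ip_unitvec_mv[OF confs_finite m, symmetric] mv_opmul)
  also have "\<dots> = ip ?C (?B (?A (unitvec \<sigma>))) (unitvec \<tau>)"
    by (simp add: ip_mv_herm[OF spin_herm[OF r(1)]] ip_mv_herm[OF spin_herm[OF r(2)]])
  also have "\<dots> = cnj (ip ?C (unitvec \<tau>) (?A (?B (unitvec \<sigma>))))"
    by (subst ip_commute) (simp add: spin_commute[OF r unitvec_vecs[OF m(1)]])
  also have "\<dots> = cnj (opmul N d (spin d a r) (spin d a r') \<tau> \<sigma>)"
    by (simp add: ip_unitvec_mv[OF confs_finite m(2,1), symmetric] mv_opmul)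
  finally show "opmul N d (spin d a r) (spin d a r') \<sigma> \<tau> = cnj (opmul N d (spin d a r) (spin d a r') \<tau> \<sigma>)" .
qed

lemma negbH_herm:
  assumes "N \<ge> 2"
  shows "herm (confs N d) (negbH N d J1 J2 \<beta>)"
  unfolding herm_def
proof (intro ballI)
  fix \<sigma> \<tau> assume m: "\<sigma> \<in> confs N d" "\<tau> \<in> confs N d"
  have e: "esum N P (\<lambda>r r'. opmul N d (spin d a r) (spin d a r') \<sigma> \<tau>)
      = cnj (esum N P (\<lambda>r r'. opmul N d (spin d a r) (spin d a r') \<tau> \<sigma>))" for P a
  proof -
    have "cnj (esum N P (\<lambda>r r'. opmul N d (spin d a r) (spin d a r') \<tau> \<sigma>))
        = esum N P (\<lambda>r r'. cnj (opmul N d (spin d a r) (spin d a r') \<tau> \<sigma>))"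
      by (rule esum_hom) simp_all
    also have "\<dots> = esum N P (\<lambda>r r'. opmul N d (spin d a r) (spin d a r') \<sigma> \<tau>)"
    proof (rule esum_cong)
      fix r r' assume r: "r \<in> torus N" and "r' = nb1 N r \<or> r' = nb2 N r"
      then have "r' \<in> torus N" "r \<noteq> r'" using nb_torus[OF r] nb_neq[OF assms r] by auto
      from herm_opmul_spin[OF r this] m
      show "cnj (opmul N d (spin d a r) (spin d a r') \<tau> \<sigma>) = opmul N d (spin d a r) (spin d a r') \<sigma> \<tau>"
        unfolding herm_def by metis
    qed
    finally show ?thesis ..
  qed
  show "negbH N d J1 J2 \<beta> \<sigma> \<tau> = cnj (negbH N d J1 J2 \<beta> \<tau> \<sigma>)"
    unfolding negbH_eq complex_cnj_add complex_cnj_mult complex_cnj_complex_of_real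
      e[of even CX] e[of odd CZ] by simp
qed

text \<open>Both halves of the theorem at once: \<open>a\<close>, \<open>J\<close> and
  \<open>P\<close> are the component, coupling and edge parity on the dominant side,
  \<open>b\<close>, \<open>J'\<close> and \<open>Q\<close> those on the weaker side.\<close>

definition roles :: "real \<Rightarrow> real \<Rightarrow> comp \<Rightarrow> comp \<Rightarrow> real \<Rightarrow> real \<Rightarrow> (nat \<Rightarrow> bool) \<Rightarrow> (nat \<Rightarrow> bool) \<Rightarrow> bool" where
  "roles J1 J2 a b J J' P Q \<longleftrightarrow>
     a = CX \<and> b = CZ \<and> J = J1 \<and> J' = J2 \<and> P = even \<and> Q = odd \<or>
     a = CZ \<and> b = CX \<and> J = J2 \<and> J' = J1 \<and> P = odd \<and> Q = even"

lemma energy_formula: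
  assumes "roles J1 J2 a b J J' P Q"
  shows "Re (ip (confs N d) v (mv (confs N d) (negbH N d J1 J2 \<beta>) v))
    = \<beta> * J / spinS d ^ 2 * esum N P (\<lambda>r r'. Re (ip (confs N d) v
        (mv (confs N d) (spin d a r) (mv (confs N d) (spin d a r') v))))
    + \<beta> * J' / spinS d ^ 2 * esum N Q (\<lambda>r r'. Re (ip (confs N d) v
        (mv (confs N d) (spin d b r) (mv (confs N d) (spin d b r') v))))"
proof -
  have Re_esum: "Re (esum N R g) = esum N R (\<lambda>r r'. Re (g r r'))" for R g
    by (rule esum_hom) simp_all
  have "Re (ip (confs N d) v (mv (confs N d) (negbH N d J1 J2 \<beta>) v))
    = \<beta> * J1 / spinS d ^ 2 * esum N even (\<lambda>r r'. Re (ip (confs N d) v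
        (mv (confs N d) (spin d CX r) (mv (confs N d) (spin d CX r') v))))
    + \<beta> * J2 / spinS d ^ 2 * esum N odd (\<lambda>r r'. Re (ip (confs N d) v
        (mv (confs N d) (spin d CZ r) (mv (confs N d) (spin d CZ r') v))))"
    unfolding negbH_eq mv_lincomb ip_add_right ip_scale_right ip_mv_esum mv_opmul plus_complex.sel
      Re_esum[symmetric] by simp
  then show ?thesis using assms by (auto simp: roles_def)
qed

lemma roles_flip:
  assumes "roles J1 J2 a b J J' P Q" "even N" "k < N"
  shows "P ((k + 1) mod N) \<longleftrightarrow> \<not> P k" "Q ((k + 1) mod N) \<longleftrightarrow> \<not> Q k"
  using assms parity_flip[OF assms(2,3)] by (auto simp: roles_def)

lemma energy_upper:
  assumes R: "roles J1 J2 a b J J' P Q" and N: "even N" "N \<ge> 2"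
    and J: "J \<ge> 0" "J' \<ge> 0" "\<beta> \<ge> 0" and v: "v \<in> vecs (confs N d)"
  shows "Re (ip (confs N d) v (mv (confs N d) (negbH N d J1 J2 \<beta>) v))
    \<le> \<beta> / spinS d ^ 2 * (J * (\<Sum>r\<in>torus N. nsq (confs N d) (mv (confs N d) (spin d a r) v))
      + J' * (\<Sum>r\<in>torus N. nsq (confs N d) (mv (confs N d) (spin d b r) v)))"
proof -
  let ?n = "\<lambda>c r. nsq (confs N d) (mv (confs N d) (spin d c r) v)"
  have *: "esum N X (\<lambda>r r'. Re (ip (confs N d) v
        (mv (confs N d) (spin d c r) (mv (confs N d) (spin d c r') v)))) \<le> (\<Sum>r\<in>torus N. ?n c r)"
    if "\<And>k. k < N \<Longrightarrow> X ((k + 1) mod N) \<longleftrightarrow> \<not> X k" for X c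
  proof -
    have "esum N X (\<lambda>r r'. Re (ip (confs N d) v
        (mv (confs N d) (spin d c r) (mv (confs N d) (spin d c r') v))))
      \<le> esum N X (\<lambda>r r'. ?n c r / 2 + ?n c r' / 2)"
    proof (rule esum_mono)
      fix r r' assume r: "r \<in> torus N"
      show "Re (ip (confs N d) v (mv (confs N d) (spin d c r) (mv (confs N d) (spin d c r') v)))
        \<le> ?n c r / 2 + ?n c r' / 2"
        unfolding ip_mv_herm[OF spin_herm[OF r], where u = v]
        using Re_ip_le by (simp add: add_divide_distrib)
    qed
    also have "\<dots> = (\<Sum>r\<in>torus N. ?n c r)"
      using esum_endpoints[where P = X and g = "\<lambda>r. ?n c r / 2", OF N(2) that]
      by (simp add: sum_divide_distrib[symmetric])
    finally show ?thesis .
  qed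
  have "Re (ip (confs N d) v (mv (confs N d) (negbH N d J1 J2 \<beta>) v))
    \<le> \<beta> * J / spinS d ^ 2 * (\<Sum>r\<in>torus N. ?n a r) + \<beta> * J' / spinS d ^ 2 * (\<Sum>r\<in>torus N. ?n b r)"
    unfolding energy_formula[OF R] using J roles_flip[OF R N(1)]
    by (intro add_mono mult_left_mono *) auto
  then show ?thesis by (simp add: algebra_simps)
qed

text \<open>On each of the N^2 edges of type \<open>P\<close> the two operators act as a product of
  eigenvalues, at least x^2 because x \<ge> 0. The edges of type \<open>Q\<close> contribute exactly
  zero by \<open>transverse_correlation_zero\<close>.\<close>

lemma trial_energy:
  assumes R: "roles J1 J2 a b J J' P Q" and N: "even N" "N \<ge> 2"
    and J: "J \<ge> 0" "\<beta> \<ge> 0" and f: "f \<in> vecs (confs N d)" "nsq (confs N d) f = 1"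
    and e: "\<And>r. r \<in> torus N \<Longrightarrow> mv (confs N d) (spin d a r) f = (\<lambda>\<sigma>. complex_of_real (\<mu> r) * f \<sigma>)"
    and \<mu>: "x \<ge> 0" "\<And>r. r \<in> torus N \<Longrightarrow> \<mu> r \<ge> x"
  shows "Re (ip (confs N d) f (mv (confs N d) (negbH N d J1 J2 \<beta>) f))
    \<ge> \<beta> * J / spinS d ^ 2 * (real N ^ 2 * x\<^sup>2)"
proof -
  let ?C = "confs N d"
  have nb: "r' \<in> torus N \<and> r \<noteq> r'" if "r \<in> torus N" "r' = nb1 N r \<or> r' = nb2 N r" for r r'
    using that(2) nb_torus[OF that(1)] nb_neq[OF N(2) that(1)] by auto
  have "esum N Q (\<lambda>r r'. Re (ip ?C f (mv ?C (spin d b r) (mv ?C (spin d b r') f)))) = esum N Q (\<lambda>_ _. 0)"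
  proof (rule esum_cong)
    fix r r' assume r: "r \<in> torus N" "r' = nb1 N r \<or> r' = nb2 N r"
    have "(a, b) = (CX, CZ) \<or> (a, b) = (CZ, CX)" using R by (auto simp: roles_def)
    from transverse_correlation_zero[OF r(1) _ _ f(1) this e[OF r(1)]] nb[OF r]
    show "Re (ip ?C f (mv ?C (spin d b r) (mv ?C (spin d b r') f))) = 0" by simp
  qed
  then have 0: "esum N Q (\<lambda>r r'. Re (ip ?C f (mv ?C (spin d b r) (mv ?C (spin d b r') f)))) = 0"
    by (simp add: esum_def)
  have "real N ^ 2 * x\<^sup>2 = esum N P (\<lambda>_ _. x\<^sup>2)"
    using esum_const[where P = P and c = "x\<^sup>2", OF N(2) roles_flip(1)[OF R N(1)]] by simp
  also have "\<dots> \<le> esum N P (\<lambda>r r'. Re (ip ?C f (mv ?C (spin d a r) (mv ?C (spin d a r') f))))"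
  proof (rule esum_mono)
    fix r r' assume r: "r \<in> torus N" "r' = nb1 N r \<or> r' = nb2 N r"
    have "x * x \<le> \<mu> r' * \<mu> r"
      using \<mu>(1) \<mu>(2)[OF r(1)] \<mu>(2)[of r'] nb[OF r] by (intro mult_mono) simp_all
    then show "x\<^sup>2 \<le> Re (ip ?C f (mv ?C (spin d a r) (mv ?C (spin d a r') f)))"
      using nb[OF r] r
      by (simp add: e mv_scale ip_scale_right ip_self f(2) power2_eq_square flip: of_real_mult)
  qed
  finally show ?thesis
    unfolding energy_formula[OF R] 0 using J
    by (simp add: mult_left_mono divide_right_mono)
qed

section \<open>Translation invariance\<close>

text \<open>Conjugation by the site permutation. Composing on the right moves an operator acting at
  \<open>r\<close> to \<open>p r\<close>, rather than to the preimage.\<close>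

definition relabel :: "(site \<Rightarrow> site) \<Rightarrow> qop \<Rightarrow> qop" where
  "relabel p A = (\<lambda>\<sigma> \<tau>. A (\<sigma> \<circ> p) (\<tau> \<circ> p))"

definition torus_perm :: "nat \<Rightarrow> (site \<Rightarrow> site) \<Rightarrow> bool" where
  "torus_perm N p \<longleftrightarrow> bij p \<and> (\<forall>r. p r \<in> torus N \<longleftrightarrow> r \<in> torus N)"

lemma bij_betw_relabel:
  assumes "torus_perm N p"
  shows "bij_betw (\<lambda>\<sigma>. \<sigma> \<circ> p) (confs N d) (confs N d)"
proof (rule bij_betw_byWitness[where f' = "\<lambda>\<sigma>. \<sigma> \<circ> inv p"])
  have p: "bij p" "\<And>r. p r \<in> torus N \<longleftrightarrow> r \<in> torus N" using assms by (auto simp only: torus_perm_def)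
  then have q: "inv p r \<in> torus N \<longleftrightarrow> r \<in> torus N" for r
    by (metis bij_inv_eq_iff)
  show "\<forall>\<sigma>\<in>confs N d. (\<sigma> \<circ> p) \<circ> inv p = \<sigma>"
    using p(1) by (simp add: comp_assoc bij_is_surj surj_iff[THEN iffD1])
  show "\<forall>\<sigma>\<in>confs N d. (\<sigma> \<circ> inv p) \<circ> p = \<sigma>"
    using p(1) by (simp add: comp_assoc bij_is_inj inj_iff[THEN iffD1])
  show "(\<lambda>\<sigma>. \<sigma> \<circ> p) ` confs N d \<subseteq> confs N d"
    unfolding confs_def using p(2) by force
  show "(\<lambda>\<sigma>. \<sigma> \<circ> inv p) ` confs N d \<subseteq> confs N d"
    unfolding confs_def using q by force
qed

lemma opmul_relabel:
  assumes "torus_perm N p"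
  shows "opmul N d (relabel p A) (relabel p B) = relabel p (opmul N d A B)"
  unfolding opmul_def relabel_def
  by (intro ext sum.reindex_bij_betw[OF bij_betw_relabel[OF assms]])

lemma optrace_relabel:
  assumes "torus_perm N p"
  shows "optrace N d (relabel p A) = optrace N d A"
  unfolding optrace_def relabel_def
  by (intro sum.reindex_bij_betw[OF bij_betw_relabel[OF assms]])

lemma comp_bij_cancel:
  assumes "bij p"
  shows "\<sigma> \<circ> p = \<tau> \<circ> p \<longleftrightarrow> \<sigma> = \<tau>"
  using assms by (metis bij_is_surj comp_assoc comp_id surj_iff)

lemma spin_relabel:
  assumes "bij p"
  shows "relabel p (spin d a r) = spin d a (p r)"
proof -
  have inj: "p x = p y \<longleftrightarrow> x = y" for x y using assms by (auto simp: bij_def inj_def)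
  have eq: "\<sigma> \<circ> p = \<tau> \<circ> p \<longleftrightarrow> \<sigma> = \<tau>" for \<sigma> \<tau> :: conf
    using assms by (rule comp_bij_cancel)
  have upd: "\<sigma> \<circ> p = (\<tau> \<circ> p)(r := x) \<longleftrightarrow> \<sigma> = \<tau>(p r := x)" for \<sigma> \<tau> :: conf and x
  proof -
    have "(\<tau> \<circ> p)(r := x) = \<tau>(p r := x) \<circ> p" by (intro ext) (simp add: inj)
    then show ?thesis by (simp only: eq)
  qed
  show ?thesis
    by (cases a) (simp_all only: relabel_def spin_def Sx_def Sy_def Sz_def Splus_def Sminus_def
        comp.case eq upd comp_apply)
qed

lemma oppow_relabel:
  assumes p: "torus_perm N p" and A: "relabel p A = A"
  shows "relabel p (oppow N d A k) = oppow N d A k"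
proof (induction k)
  case 0
  have "\<sigma> \<circ> p = \<tau> \<circ> p \<longleftrightarrow> \<sigma> = \<tau>" for \<sigma> \<tau> :: conf
    using p unfolding torus_perm_def by (intro comp_bij_cancel) blast
  then show ?case by (simp only: relabel_def opid_def oppow.simps)
next
  case (Suc k)
  show ?case unfolding oppow.simps opmul_relabel[OF p, symmetric] A Suc.IH ..
qed

lemma opexp_relabel:
  assumes "torus_perm N p" "relabel p A = A"
  shows "relabel p (opexp N d A) = opexp N d A"
proof -
  have "oppow N d A k (\<sigma> \<circ> p) (\<tau> \<circ> p) = oppow N d A k \<sigma> \<tau>" for k \<sigma> \<tau>
    using fun_cong[OF fun_cong[OF oppow_relabel[OF assms, of d k]], of \<sigma> \<tau>] by (simp add: relabel_def)
  then show ?thesis by (simp add: relabel_def opexp_def)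
qed

lemma thermal_relabel:
  assumes p: "torus_perm N p" and H: "relabel p (negbH N d J1 J2 \<beta>) = negbH N d J1 J2 \<beta>"
  shows "thermal N d J1 J2 \<beta> (relabel p B) = thermal N d J1 J2 \<beta> B"
  unfolding thermal_def Let_def negbH_def[symmetric]
  unfolding optrace_relabel[OF p, of d "opmul N d B _", symmetric] opmul_relabel[OF p, symmetric]
    opexp_relabel[OF p H] ..

lemma torus_perm_shift: "i \<le> N \<Longrightarrow> j \<le> N \<Longrightarrow> torus_perm N (shift N i j)"
  by (simp add: torus_perm_def bij_shift shift_torus)

text \<open>Even shifts respect neighbours and the parity of both coordinates, hence edge types; an
  odd shift would exchange the two types in its direction.\<close>

lemma esum_shift:
  assumes ij: "i \<le> N" "j \<le> N" "even i" "even j" and N: "even N" and P: "P = even \<or> P = odd"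
  shows "esum N P (\<lambda>r r'. g (shift N i j r) (shift N i j r')) = esum N P g"
proof -
  have par: "even ((x + k) mod N) \<longleftrightarrow> even x" if "even k" for x k
    using that N by (simp add: dvd_mod_iff)
  have P': "P (fst (shift N i j r)) \<longleftrightarrow> P (fst r)" "P (snd (shift N i j r)) \<longleftrightarrow> P (snd r)" for r
    using P ij(3,4) by (auto simp: shift_def par)
  have nb: "shift N i j (nb1 N r) = nb1 N (shift N i j r)" "shift N i j (nb2 N r) = nb2 N (shift N i j r)"
    if "r \<in> torus N" for r
    using that nb_torus[OF that] by (simp_all add: shift_def nb1_def nb2_def mod_simps add_ac)
  have "esum N P (\<lambda>r r'. g (shift N i j r) (shift N i j r'))
    = (\<Sum>r\<in>torus N. (\<lambda>r. (if P (fst r) then g r (nb1 N r) else 0)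
       + (if P (snd r) then g r (nb2 N r) else 0)) (shift N i j r))"
    unfolding esum_def by (intro sum.cong refl) (simp add: P' nb)
  also have "\<dots> = esum N P g"
    unfolding esum_def by (rule sum.reindex_bij_betw[OF bij_betw_shift[OF ij(1,2)]])
  finally show ?thesis .
qed

lemma negbH_shift:
  assumes ij: "i \<le> N" "j \<le> N" "even i" "even j" and N: "even N"
  shows "relabel (shift N i j) (negbH N d J1 J2 \<beta>) = negbH N d J1 J2 \<beta>"
proof -
  let ?p = "shift N i j"
  have "opmul N d (spin d a r) (spin d a r') (\<sigma> \<circ> ?p) (\<tau> \<circ> ?p)
      = opmul N d (spin d a (?p r)) (spin d a (?p r')) \<sigma> \<tau>" for a r r' \<sigma> \<tau>
    using fun_cong[OF fun_cong[OF opmul_relabel[OF torus_perm_shift[OF ij(1,2)],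
        of d "spin d a r" "spin d a r'"]], of \<sigma> \<tau>]
    unfolding spin_relabel[OF bij_shift[OF ij(1,2)]] by (simp add: relabel_def)
  then have *: "esum N P (\<lambda>r r'. opmul N d (spin d a r) (spin d a r') (\<sigma> \<circ> ?p) (\<tau> \<circ> ?p))
      = esum N P (\<lambda>r r'. opmul N d (spin d a r) (spin d a r') \<sigma> \<tau>)"
    if "P = even \<or> P = odd" for P a \<sigma> \<tau>
    using esum_shift[OF ij N that, of "\<lambda>r r'. opmul N d (spin d a r) (spin d a r') \<sigma> \<tau>"] by simp
  show ?thesis
    unfolding relabel_def negbH_eq by (simp add: *)
qed

section \<open>Second moments and averaging over translations\<close>

definition second_moment :: "nat \<Rightarrow> nat \<Rightarrow> real \<Rightarrow> real \<Rightarrow> real \<Rightarrow> comp \<Rightarrow> site \<Rightarrow> real" where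
  "second_moment N d J1 J2 \<beta> a r
    = Re (thermal N d J1 J2 \<beta> (opmul N d (spin d a r) (spin d a r)))"

lemma second_moment_eigenbasis:
  assumes E: "eigenbasis (confs N d) (negbH N d J1 J2 \<beta>) V l" and r: "r \<in> torus N"
  shows "second_moment N d J1 J2 \<beta> a r
    = (\<Sum>v\<in>V. gibbs V l v * nsq (confs N d) (mv (confs N d) (spin d a r) v))"
  unfolding second_moment_def Re_thermal[OF E] mv_opmul ip_mv_herm[OF spin_herm[OF r]] ip_self by simp

lemma second_moment_shift:
  assumes "i \<le> N" "j \<le> N" "even i" "even j" "even N"
  shows "second_moment N d J1 J2 \<beta> a (shift N i j r) = second_moment N d J1 J2 \<beta> a r"
proof -
  have "relabel (shift N i j) (opmul N d (spin d a r) (spin d a r))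
      = opmul N d (spin d a (shift N i j r)) (spin d a (shift N i j r))"
    unfolding opmul_relabel[OF torus_perm_shift[OF assms(1,2)], symmetric]
      spin_relabel[OF bij_shift[OF assms(1,2)]] ..
  then show ?thesis
    using thermal_relabel[OF torus_perm_shift[OF assms(1,2)] negbH_shift[OF assms],
        where B = "opmul N d (spin d a r) (spin d a r)"]
    by (simp add: second_moment_def)
qed

text \<open>Only translations by even vectors are used; they have four orbits on the torus.\<close>

lemma even_shift_average:
  fixes u :: "site \<Rightarrow> real"
  assumes N: "even N" and r: "r \<in> torus N"
    and nonneg: "\<And>r. r \<in> torus N \<Longrightarrow> u r \<ge> 0"
    and inv: "\<And>i j r. i \<le> N \<Longrightarrow> j \<le> N \<Longrightarrow> even i \<Longrightarrow> even j \<Longrightarrow> u (shift N i j r) = u r"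
  shows "real N ^ 2 * u r \<le> 4 * (\<Sum>r\<in>torus N. u r)"
proof -
  define I where "I = {..<N div 2} \<times> {..<N div 2}"
  define f where "f = (\<lambda>(i, j). shift N (2 * i) (2 * j) r)"
  have cancel: "i = i'" if "(x + 2 * i) mod N = (x + 2 * i') mod N" "x < N" "i < N div 2" "i' < N div 2"
    for x i i'
  proof -
    \<comment> \<open>Here x + 2k < 2N, so reduction subtracts N at most once, and the two
      representatives can be compared case by case.\<close>
    have *: "(x + 2 * k) mod N = (if x + 2 * k < N then x + 2 * k else x + 2 * k - N)"
      if "k < N div 2" for k
    proof (cases "x + 2 * k < N")
      case False
      then have "(x + 2 * k) mod N = (x + 2 * k - N) mod N" by (simp add: le_mod_geq)
      also have "\<dots> = x + 2 * k - N" using \<open>x < N\<close> that by (intro mod_less) linarith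
      finally show ?thesis using False by simp
    qed simp
    show ?thesis
      using that(1) unfolding *[OF that(3)] *[OF that(4)] using that(2,3,4) by (auto split: if_splits)
  qed
  have inj: "inj_on f I"
  proof (rule inj_onI)
    fix p q assume pq: "p \<in> I" "q \<in> I" "f p = f q"
    obtain i j i' j' where p: "p = (i, j)" "q = (i', j')" by (cases p, cases q) auto
    have rN: "fst r < N" "snd r < N" using r by (auto simp: torus_def)
    have "(fst r + 2 * i) mod N = (fst r + 2 * i') mod N" "(snd r + 2 * j) mod N = (snd r + 2 * j') mod N"
      using pq(3) r unfolding p by (simp_all add: f_def shift_def)
    then have "i = i'" "j = j'"
      using cancel rN pq(1,2) unfolding p I_def by blast+
    then show "p = q" unfolding p by simp
  qed
  have sub: "f ` I \<subseteq> torus N"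
    using r by (auto simp: f_def shift_torus)
  \<comment> \<open>The shifts by (2i, 2j) with i, j < N/2 reach N^2/4 distinct sites carrying the
    same value; nonnegativity adds the rest of the torus for free.\<close>
  have "real (N div 2) ^ 2 * u r = (\<Sum>p\<in>I. u r)"
    by (simp add: I_def power2_eq_square)
  also have "\<dots> = (\<Sum>p\<in>I. u (f p))"
    by (intro sum.cong refl) (auto simp: f_def I_def inv)
  also have "\<dots> = (\<Sum>r\<in>f ` I. u r)" using inj by (simp add: sum.reindex)
  also have "\<dots> \<le> (\<Sum>r\<in>torus N. u r)"
    using sub nonneg by (intro sum_mono2 torus_finite) auto
  finally have "real (N div 2) ^ 2 * u r \<le> (\<Sum>r\<in>torus N. u r)" .
  moreover have "real N = 2 * real (N div 2)" using N by (metis dvd_mult_div_cancel of_nat_mult of_nat_numeral)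
  ultimately show ?thesis by (simp add: power_mult_distrib)
qed

section \<open>Ordering in the dominant direction\<close>

lemma eigenbasis_nonempty:
  assumes "eigenbasis (confs N d) A V l"
  shows "V \<noteq> {}"
proof -
  have z: "(\<lambda>_. 0) \<in> confs N d" by (simp add: confs_def)
  show ?thesis using eigenbasis_closure[OF confs_finite assms z z] by auto
qed

lemma second_moment_nonneg:
  assumes E: "eigenbasis (confs N d) (negbH N d J1 J2 \<beta>) V l" and r: "r \<in> torus N"
  shows "second_moment N d J1 J2 \<beta> a r \<ge> 0"
  unfolding second_moment_eigenbasis[OF assms]
  using gibbs_pos[OF eigenbasisD(1)[OF E]] by (intro sum_nonneg mult_nonneg_nonneg nsq_nonneg) (simp add: less_imp_le)

lemma second_moment_casimir:
  assumes E: "eigenbasis (confs N d) (negbH N d J1 J2 \<beta>) V l" and r: "r \<in> torus N"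
  shows "second_moment N d J1 J2 \<beta> CX r + second_moment N d J1 J2 \<beta> CY r
    + second_moment N d J1 J2 \<beta> CZ r = spinS d * (spinS d + 1)"
proof -
  have "second_moment N d J1 J2 \<beta> CX r + second_moment N d J1 J2 \<beta> CY r
      + second_moment N d J1 J2 \<beta> CZ r
    = (\<Sum>v\<in>V. gibbs V l v * (nsq (confs N d) (mv (confs N d) (spin d CX r) v)
        + nsq (confs N d) (mv (confs N d) (spin d CY r) v)
        + nsq (confs N d) (mv (confs N d) (spin d CZ r) v)))"
    unfolding second_moment_eigenbasis[OF assms] by (simp add: distrib_left sum.distrib)
  also have "\<dots> = (\<Sum>v\<in>V. gibbs V l v * (spinS d * (spinS d + 1)))"
    by (intro sum.cong refl) (simp add: casimir_nsq[OF r eigenbasisD(5)[OF E]] eigenbasisD(6)[OF E])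
  also have "\<dots> = spinS d * (spinS d + 1)"
    unfolding sum_distrib_right[symmetric] gibbs_sum[OF eigenbasisD(1)[OF E] eigenbasis_nonempty[OF E]] by simp
  finally show ?thesis .
qed

lemma gibbs_energy_upper:
  assumes R: "roles J1 J2 a b J J' P Q" and N: "even N" "N \<ge> 2"
    and J: "J \<ge> 0" "J' \<ge> 0" "\<beta> \<ge> 0"
    and E: "eigenbasis (confs N d) (negbH N d J1 J2 \<beta>) V l"
  shows "(\<Sum>v\<in>V. gibbs V l v * l v)
    \<le> \<beta> / spinS d ^ 2 * (J * (\<Sum>r\<in>torus N. second_moment N d J1 J2 \<beta> a r)
      + J' * (\<Sum>r\<in>torus N. second_moment N d J1 J2 \<beta> b r))"
proof -
  let ?n = "\<lambda>c r v. nsq (confs N d) (mv (confs N d) (spin d c r) v)"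
  have l: "l v \<le> \<beta> / spinS d ^ 2 * (J * (\<Sum>r\<in>torus N. ?n a r v) + J' * (\<Sum>r\<in>torus N. ?n b r v))"
    if v: "v \<in> V" for v
  proof -
    have "l v = Re (ip (confs N d) v (mv (confs N d) (negbH N d J1 J2 \<beta>) v))"
      by (simp add: eigenbasisD(3)[OF E v] ip_scale_right ip_self eigenbasisD(6)[OF E v])
    then show ?thesis using energy_upper[OF R N J eigenbasisD(5)[OF E v]] by simp
  qed
  have sm: "(\<Sum>r\<in>torus N. second_moment N d J1 J2 \<beta> c r) = (\<Sum>v\<in>V. gibbs V l v * (\<Sum>r\<in>torus N. ?n c r v))" for c
  proof -
    have "(\<Sum>r\<in>torus N. second_moment N d J1 J2 \<beta> c r) = (\<Sum>r\<in>torus N. \<Sum>v\<in>V. gibbs V l v * ?n c r v)"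
      by (intro sum.cong refl second_moment_eigenbasis[OF E])
    also have "\<dots> = (\<Sum>v\<in>V. \<Sum>r\<in>torus N. gibbs V l v * ?n c r v)" by (rule sum.swap)
    finally show ?thesis by (simp add: sum_distrib_left)
  qed
  have "(\<Sum>v\<in>V. gibbs V l v * l v)
    \<le> (\<Sum>v\<in>V. gibbs V l v * (\<beta> / spinS d ^ 2 * (J * (\<Sum>r\<in>torus N. ?n a r v) + J' * (\<Sum>r\<in>torus N. ?n b r v))))"
    using gibbs_pos[OF eigenbasisD(1)[OF E]] l by (intro sum_mono mult_left_mono) (auto simp: less_imp_le)
  also have "\<dots> = (\<Sum>v\<in>V. \<beta> / spinS d ^ 2 * (J * (gibbs V l v * (\<Sum>r\<in>torus N. ?n a r v))
      + J' * (gibbs V l v * (\<Sum>r\<in>torus N. ?n b r v))))"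
    by (intro sum.cong refl) (simp only: distrib_left mult.left_commute)
  also have "\<dots> = \<beta> / spinS d ^ 2 * (J * (\<Sum>r\<in>torus N. second_moment N d J1 J2 \<beta> a r)
      + J' * (\<Sum>r\<in>torus N. second_moment N d J1 J2 \<beta> b r))"
    unfolding sm sum_distrib_left[symmetric] sum.distrib ..
  finally show ?thesis .
qed

lemma gibbs_energy_lower:
  assumes R: "roles J1 J2 a b J J' P Q" and N: "even N" "N \<ge> 2" and d: "d \<ge> 1"
    and J: "J \<ge> 0" "\<beta> \<ge> 0" and eps: "0 < \<epsilon>" "\<epsilon> \<le> 1 / 2"
    and E: "eigenbasis (confs N d) (negbH N d J1 J2 \<beta>) V l"
  shows "(\<Sum>v\<in>V. gibbs V l v * l v) \<ge> real N ^ 2 * (\<beta> * J * (1 - 4 * \<epsilon>) - ln (2 / \<epsilon>))"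
proof -
  let ?C = "confs N d"
  define S where "S = spinS d"
  have S: "S > 0" "real d = 2 * S" using d by (auto simp: S_def spinS_def)
  \<comment> \<open>At each site the top k + 1 of the d + 1 eigenvalues are kept. With d = 2S the
    lowest of them is S - k \<ge> S(1 - 2\<epsilon>), and squaring costs at most
    4\<epsilon>.\<close>
  define k where "k = nat \<lfloor>\<epsilon> * real d\<rfloor>"
  have k: "real k \<le> \<epsilon> * real d" "\<epsilon> * real d < real k + 1"
    using eps by (auto simp: k_def)
  have "\<epsilon> * real d \<le> 1 / 2 * real d" using eps by (intro mult_right_mono) auto
  then have kd: "k \<le> d" using k(1) by linarith
  define M where "M = topconfs N d (d - k)"
  have MC: "M \<subseteq> ?C" by (auto simp: M_def topconfs_def)
  have finM: "finite M" using finite_subset[OF MC confs_finite] .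
  have cardM: "card M = (k + 1) ^ (N * N)"
    using kd by (simp add: M_def card_topconfs Suc_diff_le)
  then have "card M > 0" by simp
  then have neM: "M \<noteq> {}" by auto
  have aa: "a = CX \<or> a = CZ" using R by (auto simp: roles_def)
  obtain f where f: "orthonormal ?C ?C f" "\<And>m r. m \<in> ?C \<Longrightarrow> r \<in> torus N \<Longrightarrow>
      mv ?C (spin d a r) (f m) = (\<lambda>\<sigma>. of_real (Mval d (m r)) * f m \<sigma>)"
    using trial_family[OF aa, of N d thesis] by blast
  have oM: "orthonormal ?C M f"
    using f(1) MC unfolding orthonormal_def by blast
  define x where "x = S - real k"
  have x: "x \<ge> S * (1 - 2 * \<epsilon>)" using k(1) S by (simp add: x_def algebra_simps)
  have S2: "S * (1 - 2 * \<epsilon>) \<ge> 0" using S eps by simp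
  have x0: "x \<ge> 0" using x S2 by linarith
  have "S\<^sup>2 * (1 - 4 * \<epsilon>) \<le> (S * (1 - 2 * \<epsilon>))\<^sup>2"
    using S(1) eps(1) by (simp add: power2_eq_square algebra_simps)
  also have "\<dots> \<le> x\<^sup>2" using x S2 by (intro power_mono)
  finally have x2: "S\<^sup>2 * (1 - 4 * \<epsilon>) \<le> x\<^sup>2" .
  have "Re (ip ?C (f m) (mv ?C (negbH N d J1 J2 \<beta>) (f m))) \<ge> \<beta> * J / spinS d ^ 2 * (real N ^ 2 * x\<^sup>2)"
    if m: "m \<in> M" for m
  proof (rule trial_energy[OF R N J _ _ f(2) x0])
    have mC: "m \<in> ?C" using m MC by blast
    show "m \<in> ?C" by (rule mC)
    show "f m \<in> vecs ?C" using f(1) mC by (simp add: orthonormal_def)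
    show "nsq ?C (f m) = 1" by (rule orthonormal_nsq[OF f(1) mC])
    fix r assume r: "r \<in> torus N"
    show "r \<in> torus N" by (rule r)
    have "d - k \<le> m r" using m r by (auto simp: M_def topconfs_def)
    then have "real d - real k \<le> real (m r)" using kd by linarith
    then show "x \<le> Mval d (m r)" using S(2) by (simp add: x_def Mval_def)
  qed
  from gibbs_energy_lower_bound[OF confs_finite negbH_herm[OF N(2)] E finM neM oM this]
  have low: "(\<Sum>v\<in>V. gibbs V l v * l v)
     \<ge> \<beta> * J / S ^ 2 * (real N ^ 2 * x\<^sup>2) - ln (real (card ?C) / real (card M))"
    unfolding S_def .
  have "\<beta> * J * (1 - 4 * \<epsilon>) * real N ^ 2 = \<beta> * J / S ^ 2 * (real N ^ 2 * (S\<^sup>2 * (1 - 4 * \<epsilon>)))"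
    using S by (simp add: field_simps)
  also have "\<dots> \<le> \<beta> * J / S ^ 2 * (real N ^ 2 * x\<^sup>2)"
    using J x2 by (intro mult_left_mono) auto
  finally have e: "\<beta> * J * (1 - 4 * \<epsilon>) * real N ^ 2 \<le> \<beta> * J / S ^ 2 * (real N ^ 2 * x\<^sup>2)" .
  \<comment> \<open>The product \<epsilon>d is below k + 1, and the extra \<epsilon> \<le> 1/2 is
    absorbed by the second k + 1. So the kept fraction per site is at least \<epsilon>/2 for every
    d.\<close>
  have "\<epsilon> * (real d + 1) \<le> 2 * (real k + 1)" using k(2) eps by (simp add: distrib_left)
  then have "(real d + 1) / (real k + 1) \<le> 2 / \<epsilon>"
    using eps by (simp add: field_simps)
  then have ln1: "ln ((real d + 1) / (real k + 1)) \<le> ln (2 / \<epsilon>)"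
    by (intro ln_mono) auto
  have "real (card ?C) / real (card M) = ((real d + 1) / (real k + 1)) ^ (N * N)"
    by (simp add: card_confs cardM power_divide add.commute)
  then have "ln (real (card ?C) / real (card M)) = real (N * N) * ln ((real d + 1) / (real k + 1))"
    by (simp only: ln_realpow)
  also have "\<dots> \<le> real (N * N) * ln (2 / \<epsilon>)" by (intro mult_left_mono ln1) simp
  finally show ?thesis using low e by (simp add: power2_eq_square algebra_simps)
qed

text \<open>The three errors have separate origins: J/S is the excess of S(S+1) over S^2,
  4\<epsilon>J is the energy loss of the trial state, and the logarithm is its entropy deficit. The
  factor 4 counts the orbits of even translations.\<close>

lemma transverse_moment_bound:
  assumes R: "roles J1 J2 a b J J' P Q" and N: "even N" "N \<ge> 2" and d: "d \<ge> 1"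
    and J: "J' < J" "J' \<ge> 0" "\<beta> > 0" and eps: "0 < \<epsilon>" "\<epsilon> \<le> 1 / 2" and r: "r \<in> torus N"
    and E: "eigenbasis (confs N d) (negbH N d J1 J2 \<beta>) V l"
  shows "(J - J') * (second_moment N d J1 J2 \<beta> CY r + second_moment N d J1 J2 \<beta> b r)
    \<le> 4 * spinS d ^ 2 * (J / spinS d + 4 * \<epsilon> * J + ln (2 / \<epsilon>) / \<beta>)"
proof -
  define S where "S = spinS d"
  have S: "S > 0" using d by (simp add: S_def spinS_def)
  let ?m = "second_moment N d J1 J2 \<beta>"
  let ?s = "\<lambda>c. \<Sum>r\<in>torus N. ?m c r"
  have "?s CX + ?s CY + ?s CZ = (\<Sum>r\<in>torus N. S * (S + 1))"
    unfolding sum.distrib[symmetric] by (intro sum.cong refl) (simp add: second_moment_casimir[OF E] S_def)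
  also have "\<dots> = real N ^ 2 * (S * (S + 1))" by (simp add: card_torus power2_eq_square)
  finally have cas: "?s a = real N ^ 2 * (S * (S + 1)) - ?s CY - ?s b"
    using R by (auto simp: roles_def)
  have "real N ^ 2 * (\<beta> * J * (1 - 4 * \<epsilon>) - ln (2 / \<epsilon>)) \<le> \<beta> / S ^ 2 * (J * ?s a + J' * ?s b)"
    using gibbs_energy_lower[OF R N d _ _ eps E] gibbs_energy_upper[OF R N _ J(2) _ E] J
    unfolding S_def by linarith
  then have "S\<^sup>2 / \<beta> * (real N ^ 2 * (\<beta> * J * (1 - 4 * \<epsilon>) - ln (2 / \<epsilon>)))
     \<le> S\<^sup>2 / \<beta> * (\<beta> / S ^ 2 * (J * ?s a + J' * ?s b))"
    using J by (intro mult_left_mono) auto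
  also have "S\<^sup>2 / \<beta> * (\<beta> / S ^ 2 * (J * ?s a + J' * ?s b)) = J * ?s a + J' * ?s b"
    using J S by simp
  also have "S\<^sup>2 / \<beta> * (real N ^ 2 * (\<beta> * J * (1 - 4 * \<epsilon>) - ln (2 / \<epsilon>)))
     = real N ^ 2 * (S\<^sup>2 * J * (1 - 4 * \<epsilon>) - S\<^sup>2 * (ln (2 / \<epsilon>) / \<beta>))"
    using J by (simp add: field_simps)
  finally have "J * ?s CY + (J - J') * ?s b
     \<le> real N ^ 2 * (J * (S * (S + 1)) - S\<^sup>2 * J * (1 - 4 * \<epsilon>) + S\<^sup>2 * (ln (2 / \<epsilon>) / \<beta>))"
    unfolding cas by (simp add: algebra_simps)
  also have "J * (S * (S + 1)) - S\<^sup>2 * J * (1 - 4 * \<epsilon>) + S\<^sup>2 * (ln (2 / \<epsilon>) / \<beta>)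
     = S\<^sup>2 * (J / S + 4 * \<epsilon> * J + ln (2 / \<epsilon>) / \<beta>)"
    using S by (simp add: field_simps power2_eq_square)
  finally have 1: "J * ?s CY + (J - J') * ?s b
     \<le> real N ^ 2 * (S\<^sup>2 * (J / S + 4 * \<epsilon> * J + ln (2 / \<epsilon>) / \<beta>))" .
  have "0 \<le> ?s CY" by (intro sum_nonneg second_moment_nonneg[OF E])
  \<comment> \<open>Replacing the dominant coupling itself carries penalty \<open>J\<close> for
    \<open>y\<close> but only \<open>J - J'\<close> for \<open>b\<close>. The former is weakened so
    that both share one factor.\<close>
  then have 2: "(J - J') * ?s CY \<le> J * ?s CY" using J by (intro mult_right_mono) auto
  have "real N ^ 2 * (?m CY r + ?m b r) \<le> 4 * (\<Sum>r\<in>torus N. ?m CY r + ?m b r)"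
    using second_moment_nonneg[OF E]
    by (intro even_shift_average[OF N(1) r]) (simp_all add: second_moment_shift[OF _ _ _ _ N(1)])
  then have "(J - J') * (real N ^ 2 * (?m CY r + ?m b r)) \<le> (J - J') * (4 * (?s CY + ?s b))"
    using J by (intro mult_left_mono) (auto simp: sum.distrib)
  also have "\<dots> \<le> 4 * (J * ?s CY + (J - J') * ?s b)"
    using 2 by (simp add: distrib_left)
  also have "\<dots> \<le> 4 * (real N ^ 2 * (S\<^sup>2 * (J / S + 4 * \<epsilon> * J + ln (2 / \<epsilon>) / \<beta>)))"
    using 1 by simp
  finally have "real N ^ 2 * ((J - J') * (?m CY r + ?m b r))
      \<le> real N ^ 2 * (4 * S\<^sup>2 * (J / S + 4 * \<epsilon> * J + ln (2 / \<epsilon>) / \<beta>))"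
    by (simp add: mult_ac)
  then show ?thesis using N(2) unfolding S_def by simp
qed

lemma corr_eigenbasis:
  assumes E: "eigenbasis (confs N d) (negbH N d J1 J2 \<beta>) V l"
    and r: "r \<in> torus N" "r' \<in> torus N"
  shows "corr N d J1 J2 \<beta> a r r' * spinS d ^ 4 = (\<Sum>v\<in>V. gibbs V l v *
    nsq (confs N d) (mv (confs N d) (spin d a r') (mv (confs N d) (spin d a r) v)))"
\<comment> \<open>For d = 0 the division inside \<open>corr\<close> is by 0; there both sides
  vanish. Multiplying by S^4 keeps the identity uniform.\<close>
proof (cases "d = 0")
  case True
  then have "nsq (confs N d) (mv (confs N d) (spin d a r') (mv (confs N d) (spin d a r) v)) = 0" for v
    using nsq_spin_le[OF r(2) mv_vecs, where d = d and a = a]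
      nsq_nonneg[of "confs N d" "mv (confs N d) (spin d a r') (mv (confs N d) (spin d a r) v)"]
    by (simp add: spinS_def order_antisym)
  then show ?thesis using True by (simp add: spinS_def)
next
  case False
  then have "spinS d ^ 4 \<noteq> 0" by (simp add: spinS_def)
  then have "corr N d J1 J2 \<beta> a r r' * spinS d ^ 4 = Re (thermal N d J1 J2 \<beta>
      (opmul N d (opmul N d (opmul N d (spin d a r) (spin d a r)) (spin d a r')) (spin d a r')))"
    unfolding corr_def by simp
  also have "\<dots> = (\<Sum>v\<in>V. gibbs V l v *
      nsq (confs N d) (mv (confs N d) (spin d a r') (mv (confs N d) (spin d a r) v)))"
    unfolding Re_thermal[OF E]
    by (intro sum.cong refl) (simp only: ip_spin_quartic[OF r eigenbasisD(5)[OF E]] Re_complex_of_real)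
  finally show ?thesis .
qed

lemma corr_le:
  assumes E: "eigenbasis (confs N d) (negbH N d J1 J2 \<beta>) V l"
    and r: "r \<in> torus N" "r' \<in> torus N"
  shows "corr N d J1 J2 \<beta> a r r' * spinS d ^ 4 \<le> spinS d * (spinS d + 1) * second_moment N d J1 J2 \<beta> a r"
proof -
  have "corr N d J1 J2 \<beta> a r r' * spinS d ^ 4
     \<le> (\<Sum>v\<in>V. gibbs V l v * (spinS d * (spinS d + 1) * nsq (confs N d) (mv (confs N d) (spin d a r) v)))"
    unfolding corr_eigenbasis[OF assms] using gibbs_pos[OF eigenbasisD(1)[OF E]]
    by (intro sum_mono mult_left_mono nsq_spin_le[OF r(2) mv_vecs]) (simp add: less_imp_le)
  also have "\<dots> = spinS d * (spinS d + 1) * second_moment N d J1 J2 \<beta> a r"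
    unfolding second_moment_eigenbasis[OF E r(1)] sum_distrib_left by (simp add: mult_ac)
  finally show ?thesis .
qed

text \<open>The Gibbs average of \<open>quartic_ge\<close>. Only the two one-site moments occur on
  the right, which is why the distance between the sites never matters.\<close>

lemma corr_ge:
  assumes E: "eigenbasis (confs N d) (negbH N d J1 J2 \<beta>) V l"
    and r: "r \<in> torus N" "r' \<in> torus N"
  shows "corr N d J1 J2 \<beta> a r r' * spinS d ^ 4 \<ge> spinS d * (spinS d + 1) *
    (second_moment N d J1 J2 \<beta> a r + second_moment N d J1 J2 \<beta> a r') - (spinS d * (spinS d + 1))\<^sup>2"
proof -
  define s where "s = spinS d * (spinS d + 1)"
  let ?n = "\<lambda>r v. nsq (confs N d) (mv (confs N d) (spin d a r) v)"
  have "s * (second_moment N d J1 J2 \<beta> a r + second_moment N d J1 J2 \<beta> a r') - s\<^sup>2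
     = (\<Sum>v\<in>V. s * (gibbs V l v * ?n r v) + s * (gibbs V l v * ?n r' v) - gibbs V l v * s\<^sup>2)"
    unfolding second_moment_eigenbasis[OF E r(1)] second_moment_eigenbasis[OF E r(2)]
      sum_subtractf sum.distrib sum_distrib_left[symmetric] sum_distrib_right[symmetric]
      gibbs_sum[OF eigenbasisD(1)[OF E] eigenbasis_nonempty[OF E]] by (simp add: distrib_left)
  also have "\<dots> = (\<Sum>v\<in>V. gibbs V l v * (s * (?n r v + ?n r' v) - s\<^sup>2 * nsq (confs N d) v))"
    by (intro sum.cong refl) (simp add: eigenbasisD(6)[OF E] algebra_simps)
  also have "\<dots> \<le> (\<Sum>v\<in>V. gibbs V l v *
      nsq (confs N d) (mv (confs N d) (spin d a r') (mv (confs N d) (spin d a r) v)))"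
    unfolding s_def using gibbs_pos[OF eigenbasisD(1)[OF E]]
    by (intro sum_mono mult_left_mono quartic_ge[OF r eigenbasisD(5)[OF E]]) (auto simp: less_imp_le)
  finally show ?thesis unfolding corr_eigenbasis[OF assms] s_def .
qed

lemma dominant_ordering:
  assumes R: "roles J1 J2 a b J J' P Q" and J: "J' < J" "J' > 0" and \<delta>: "\<delta> > 0"
  shows "\<exists>c>0. \<exists>\<beta>0. \<forall>\<beta>\<ge>\<beta>0. \<forall>d::nat. d \<ge> 1 \<and> spinS d \<ge> c * \<beta>^2 \<longrightarrow>
     (\<exists>N0. \<forall>N\<ge>N0. even N \<longrightarrow>
        (\<forall>r\<in>torus N. \<forall>r'\<in>torus N.
           corr N d J1 J2 \<beta> a r r' \<ge> 1 - 2 * \<delta> \<and>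
           corr N d J1 J2 \<beta> CY r r' < \<delta> \<and>
           corr N d J1 J2 \<beta> b r r' < \<delta>))"
proof -
  \<comment> \<open>Chosen so that 4 S^2 \<theta> = (J - J') (\<delta>/2) S^2; each of the three
    errors is then made at most \<theta>/4, leaving room for a strict bound.\<close>
  define \<theta> where "\<theta> = \<delta> * (J - J') / 8"
  have \<theta>: "\<theta> > 0" using J \<delta> by (simp add: \<theta>_def)
  define \<epsilon> where "\<epsilon> = min (1 / 2) (\<theta> / (16 * J))"
  have eps: "0 < \<epsilon>" "\<epsilon> \<le> 1 / 2" using J \<theta> by (auto simp: \<epsilon>_def)
  have "\<epsilon> \<le> \<theta> / (16 * J)" by (simp add: \<epsilon>_def)
  then have epsJ: "4 * \<epsilon> * J \<le> \<theta> / 4" using J by (simp add: field_simps)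
  define L where "L = ln (2 / \<epsilon>)"
  define \<beta>0 where "\<beta>0 = max 1 (max (4 * L / \<theta>) (4 * J / \<theta>))"
  have main: "corr N d J1 J2 \<beta> a r r' \<ge> 1 - 2 * \<delta> \<and>
           corr N d J1 J2 \<beta> CY r r' < \<delta> \<and> corr N d J1 J2 \<beta> b r r' < \<delta>"
    if \<beta>: "\<beta> \<ge> \<beta>0" and d: "d \<ge> 1" "spinS d \<ge> 1 * \<beta>\<^sup>2" and N: "even N" "N \<ge> 2"
      and r: "r \<in> torus N" "r' \<in> torus N" for \<beta> d N r r'
  proof -
    define S where "S = spinS d"
    define s where "s = S * (S + 1)"
    have b1: "\<beta> \<ge> 1" "\<beta> \<ge> 4 * L / \<theta>" "\<beta> \<ge> 4 * J / \<theta>" using \<beta> by (auto simp: \<beta>0_def)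
    \<comment> \<open>Since \<beta>0 \<ge> 1 and c = 1, the hypothesis on S yields S \<ge> \<beta>,
      so the threshold 4J/\<theta> built into \<beta>0 also bounds S from below.\<close>
    have "\<beta> \<le> \<beta>\<^sup>2" using b1(1) by (simp add: power2_eq_square)
    then have SB: "S \<ge> \<beta>" using d(2) by (simp add: S_def)
    then have S1: "S \<ge> 1" using b1 by linarith
    have "L / \<beta> \<le> \<theta> / 4" using b1 \<theta> by (simp add: field_simps)
    moreover have "J / S \<le> \<theta> / 4"
    proof -
      have "4 * J / \<theta> \<le> S" using b1(3) SB by linarith
      then show ?thesis using \<theta> S1 by (simp add: field_simps)
    qed
    ultimately have t: "J / S + 4 * \<epsilon> * J + L / \<beta> < \<theta>" using epsJ \<theta> by linarith
    obtain V l where E: "eigenbasis (confs N d) (negbH N d J1 J2 \<beta>) V l"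
      using eigenbasis_exists[OF confs_finite negbH_herm[OF N(2)]] by blast
    let ?m = "second_moment N d J1 J2 \<beta>"
    have tr: "?m CY q + ?m b q < \<delta> / 2 * S\<^sup>2" if q: "q \<in> torus N" for q
    proof -
      have "(J - J') * (?m CY q + ?m b q) \<le> 4 * S\<^sup>2 * (J / S + 4 * \<epsilon> * J + L / \<beta>)"
        unfolding S_def L_def using J b1(1)
        by (intro transverse_moment_bound[OF R N d(1) _ _ _ eps q E]) auto
      also have "\<dots> < 4 * S\<^sup>2 * \<theta>" using t S1 by (intro mult_strict_left_mono) auto
      also have "\<dots> = (J - J') * (\<delta> / 2 * S\<^sup>2)" by (simp add: \<theta>_def)
      finally show ?thesis using J by simp
    qed
    have S4: "S ^ 4 > 0" "S ^ 4 = S\<^sup>2 * S\<^sup>2" using S1 by (auto simp: power2_eq_square power4_eq_xxxx)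
    have "s > 0" unfolding s_def using S1 by (intro mult_pos_pos) auto
    \<comment> \<open>S \<ge> 1 gives S(S+1) \<le> 2 S^2. This factor 2 turns the moment bound
      \<delta>/2 into \<delta> for the small correlations, and the loss \<delta> into 2\<delta> for
      the large one.\<close>
    then have s: "S\<^sup>2 \<le> s" "s \<le> 2 * S\<^sup>2" "s > 0"
      using S1 by (auto simp: s_def power2_eq_square distrib_left)
    have small: "corr N d J1 J2 \<beta> c r r' < \<delta>" if c: "c = CY \<or> c = b" for c
    proof -
      have "?m c r < \<delta> / 2 * S\<^sup>2"
        using tr[OF r(1)] second_moment_nonneg[OF E r(1), of CY] second_moment_nonneg[OF E r(1), of b] c
        by auto
      then have "s * ?m c r < s * (\<delta> / 2 * S\<^sup>2)" using s by simp
      also have "\<dots> \<le> 2 * S\<^sup>2 * (\<delta> / 2 * S\<^sup>2)" using s \<delta> by (intro mult_right_mono) auto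
      also have "\<dots> = \<delta> * S ^ 4" unfolding S4(2) by simp
      finally have "corr N d J1 J2 \<beta> c r r' * S ^ 4 < \<delta> * S ^ 4"
        using corr_le[OF E r, of c, folded S_def, folded s_def] by linarith
      then show ?thesis using S4(1) by simp
    qed
    have ma: "?m a q > s - \<delta> / 2 * S\<^sup>2" if q: "q \<in> torus N" for q
      using second_moment_casimir[OF E q, folded S_def, folded s_def] tr[OF q] R
      unfolding roles_def by (elim disjE conjE) simp_all
    have "s\<^sup>2 - s * (\<delta> * S\<^sup>2) = s * ((s - \<delta> / 2 * S\<^sup>2) + (s - \<delta> / 2 * S\<^sup>2)) - s\<^sup>2"
      by (simp add: power2_eq_square algebra_simps)
    also have "\<dots> \<le> s * (?m a r + ?m a r') - s\<^sup>2"
      using ma[OF r(1)] ma[OF r(2)] s by (intro diff_right_mono mult_left_mono) auto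
    also have "\<dots> \<le> corr N d J1 J2 \<beta> a r r' * S ^ 4"
      by (rule corr_ge[OF E r, of a, folded S_def, folded s_def])
    finally have "s\<^sup>2 - s * (\<delta> * S\<^sup>2) \<le> corr N d J1 J2 \<beta> a r r' * S ^ 4" .
    moreover have "s * (\<delta> * S\<^sup>2) \<le> 2 * S\<^sup>2 * (\<delta> * S\<^sup>2)" using s \<delta> by (intro mult_right_mono) auto
    moreover have "S\<^sup>2 * S\<^sup>2 \<le> s\<^sup>2" unfolding power2_eq_square[of s] using s by (intro mult_mono) auto
    ultimately have "(1 - 2 * \<delta>) * S ^ 4 \<le> corr N d J1 J2 \<beta> a r r' * S ^ 4"
      unfolding S4(2) by (simp add: algebra_simps)
    then have "1 - 2 * \<delta> \<le> corr N d J1 J2 \<beta> a r r'" using S4(1) by simp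
    then show ?thesis using small by blast
  qed
  show ?thesis
    \<comment> \<open>The witnesses are c = 1, the \<beta>0 above and N0 = 2; from N = 2 on the two
      ends of an edge are distinct sites.\<close>
    by (rule exI[of _ 1], intro conjI zero_less_one, rule exI[of _ \<beta>0], intro allI impI,
        rule exI[of _ 2]) (use main in blast)
qed

theorem theorem2p6:
  fixes J1 J2 :: real
  shows
   "(J1 > J2 \<and> J2 > 0 \<longrightarrow>
      (\<forall>\<delta>>0. \<exists>c>0. \<exists>\<beta>0. \<forall>\<beta>\<ge>\<beta>0. \<forall>d::nat. d \<ge> 1 \<and> spinS d \<ge> c * \<beta>^2 \<longrightarrow>
         (\<exists>N0. \<forall>N\<ge>N0. even N \<longrightarrow>
            (\<forall>r\<in>torus N. \<forall>r'\<in>torus N.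
               corr N d J1 J2 \<beta> CX r r' \<ge> 1 - 2 * \<delta> \<and>
               corr N d J1 J2 \<beta> CY r r' < \<delta> \<and>
               corr N d J1 J2 \<beta> CZ r r' < \<delta>))))
  \<and> (J2 > J1 \<and> J1 > 0 \<longrightarrow>
      (\<forall>\<delta>>0. \<exists>c>0. \<exists>\<beta>0. \<forall>\<beta>\<ge>\<beta>0. \<forall>d::nat. d \<ge> 1 \<and> spinS d \<ge> c * \<beta>^2 \<longrightarrow>
         (\<exists>N0. \<forall>N\<ge>N0. even N \<longrightarrow>
            (\<forall>r\<in>torus N. \<forall>r'\<in>torus N.
               corr N d J1 J2 \<beta> CZ r r' \<ge> 1 - 2 * \<delta> \<and>
               corr N d J1 J2 \<beta> CY r r' < \<delta> \<and>
               corr N d J1 J2 \<beta> CX r r' < \<delta>))))"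
proof (intro conjI impI allI)
  fix \<delta> :: real
  assume "J1 > J2 \<and> J2 > 0" and \<delta>: "\<delta> > 0"
  then have J: "J1 > J2" "J2 > 0" by auto
  have "roles J1 J2 CX CZ J1 J2 even odd" by (simp add: roles_def)
  from dominant_ordering[OF this J \<delta>]
  show "\<exists>c>0. \<exists>\<beta>0. \<forall>\<beta>\<ge>\<beta>0. \<forall>d::nat. d \<ge> 1 \<and> spinS d \<ge> c * \<beta>^2 \<longrightarrow>
         (\<exists>N0. \<forall>N\<ge>N0. even N \<longrightarrow>
            (\<forall>r\<in>torus N. \<forall>r'\<in>torus N.
               corr N d J1 J2 \<beta> CX r r' \<ge> 1 - 2 * \<delta> \<and>
               corr N d J1 J2 \<beta> CY r r' < \<delta> \<and>
               corr N d J1 J2 \<beta> CZ r r' < \<delta>))" .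
next
  fix \<delta> :: real
  assume "J2 > J1 \<and> J1 > 0" and \<delta>: "\<delta> > 0"
  then have J: "J2 > J1" "J1 > 0" by auto
  have "roles J1 J2 CZ CX J2 J1 odd even" by (simp add: roles_def)
  from dominant_ordering[OF this J \<delta>]
  show "\<exists>c>0. \<exists>\<beta>0. \<forall>\<beta>\<ge>\<beta>0. \<forall>d::nat. d \<ge> 1 \<and> spinS d \<ge> c * \<beta>^2 \<longrightarrow>
         (\<exists>N0. \<forall>N\<ge>N0. even N \<longrightarrow>
            (\<forall>r\<in>torus N. \<forall>r'\<in>torus N.
               corr N d J1 J2 \<beta> CZ r r' \<ge> 1 - 2 * \<delta> \<and>
               corr N d J1 J2 \<beta> CY r r' < \<delta> \<and>
               corr N d J1 J2 \<beta> CX r r' < \<delta>))" .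
qed

end
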